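(* Let $\mathbb{K}$ be a field, let $m\ge 2$, $r\ge 2$, and let $n_1,\dots,n_r$ be positive integers with $n_r\ge 2$ and $1=n_1=n_2=\cdots=n_{s-1}<n_s\le\cdots\le n_r$ for some $s\in\{1,\dots,r\}$. Put $n=\sum_{j=1}^r n_j$, let $G=K_{n_1,\dots,n_r}$ be the complete $r$-partite graph on $[n]$, and let $S=\mathbb{K}[x_{ij}: i\in[m],\, j\in[n]]$. Then \[ \operatorname{depth}(S/\mathcal{J}_{K_m,G})=m+n_s . \]
   Context: For a positive integer $a$, $[a]=\{1,\dots,a\}$. For a finite simple graph $H$ on the vertex set $[n]$, the generalized binomial edge ideal of $H$ is the ideal $\mathcal{J}_{K_m,H}$ of $S=\mathbb{K}[x_{ij}: i\in[m], j\in[n]]$ generated by all $2$-minors $x_{ik}x_{jl}-x_{il}x_{jk}$ with $1\le i<j\le m$ and $\{k,l\}\in E(H)$, $k<l$. The complete $r$-partite graph $K_{n_1,\dots,n_r}$ has vertex set $[n]=V_1\sqcup\cdots\sqcup V_r$, where $V_k=\{1+\sum_{j=1}^{k-1}n_j,\dots,\sum_{j=1}^{k}n_j\}$, and two vertices are adjacent if and only if they lie in different parts. The index $s$ is the smallest index with $n_s\ge 2$. Depth is taken with respect to the graded maximal ideal of the standard graded ring $S$. *)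

theory Defs
  imports
    "HOL-Library.Poly_Mapping"
    "HOL-Library.Extended_Nat"
    "HOL-Algebra.QuotRing"
    "HOL-Algebra.Module"
begin

section \<open>Depth of a module\<close>

text \<open>\<open>IM_span R M A\<close> is the submodule \<open>(A)M\<close> of \<open>M\<close> generated by all products \<open>a x\<close> with
  \<open>a \<in> A\<close> and \<open>x \<in> M\<close>; for \<open>A = {}\<close> it is the zero submodule.\<close>

definition IM_span ::
  "('a, 'c) ring_scheme \<Rightarrow> ('a, 'b, 'd) module_scheme \<Rightarrow> 'a set \<Rightarrow> 'b set" where
  "IM_span R M A =
     \<Inter> {N. submodule N R M \<and> {a \<odot>\<^bsub>M\<^esub> x | a x. a \<in> A \<and> x \<in> carrier M} \<subseteq> N}"

text \<open>\<open>f\<^sub>1, \<dots>, f\<^sub>d\<close> is \<open>M\<close>-regular if each \<open>f\<^sub>i\<close> is a nonzerodivisor on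
  \<open>M/(f\<^sub>1, \<dots>, f\<^bsub>i-1\<^esub>)M\<close>, here spelled out on representatives in \<open>M\<close>, and
  \<open>M/(f\<^sub>1, \<dots>, f\<^sub>d)M \<noteq> 0\<close>.  List indices start at 0.\<close>

definition regular_sequence ::
  "('a, 'c) ring_scheme \<Rightarrow> ('a, 'b, 'd) module_scheme \<Rightarrow> 'a list \<Rightarrow> bool" where
  "regular_sequence R M fs \<longleftrightarrow>
     set fs \<subseteq> carrier R \<and>
     (\<forall>i < length fs. \<forall>x \<in> carrier M.
        (fs ! i) \<odot>\<^bsub>M\<^esub> x \<in> IM_span R M (set (take i fs)) \<longrightarrow>
          x \<in> IM_span R M (set (take i fs))) \<and>
     IM_span R M (set fs) \<noteq> carrier M"

text \<open>The depth of \<open>M\<close> with respect to an ideal \<open>I\<close>: the supremum of the lengths of \<open>M\<close>-regular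
  sequences in \<open>I\<close>, with the usual convention \<open>\<infinity>\<close> if \<open>I M = M\<close>.\<close>

definition depth ::
  "('a, 'c) ring_scheme \<Rightarrow> 'a set \<Rightarrow> ('a, 'b, 'd) module_scheme \<Rightarrow> enat" where
  "depth R I M =
     (if IM_span R M I = carrier M then \<infinity>
      else Sup {enat (length fs) | fs. set fs \<subseteq> I \<and> regular_sequence R M fs})"

text \<open>The quotient ring \<open>R/J\<close> as an \<open>R\<close>-module.\<close>

definition quotient_module ::
  "('a, 'c) ring_scheme \<Rightarrow> 'a set \<Rightarrow> ('a, 'a set) module" where
  "quotient_module R J =
     ring.extend (R Quot J)
       \<lparr>smult = (\<lambda>a C. (J +>\<^bsub>R\<^esub> a) \<otimes>\<^bsub>R Quot J\<^esub> C)\<rparr>"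

lemma quotient_module_simps:
  "carrier (quotient_module R J) = carrier (R Quot J)"
  "mult (quotient_module R J) = mult (R Quot J)"
  "one (quotient_module R J) = one (R Quot J)"
  "zero (quotient_module R J) = zero (R Quot J)"
  "add (quotient_module R J) = add (R Quot J)"
  "a \<odot>\<^bsub>quotient_module R J\<^esub> C = (J +>\<^bsub>R\<^esub> a) \<otimes>\<^bsub>R Quot J\<^esub> C"
  by (simp_all add: quotient_module_def ring.extend_def)

lemma quotient_module_is_module:
  assumes "cring R" "ideal J R"
  shows "module R (quotient_module R J)"
proof -
  interpret ideal J R by fact
  interpret R: cring R by fact
  interpret Q: cring "R Quot J" by (rule quotient_is_cring[OF assms(1)])
  interpret h: ring_hom_ring R "R Quot J" "(+>\<^bsub>R\<^esub>) J" by (rule rcos_ring_hom_ring)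
  show ?thesis
  proof (rule moduleI)
    show "abelian_group (quotient_module R J)"
    proof (rule abelian_groupI)
      show "\<exists>y\<in>carrier (quotient_module R J). y \<oplus>\<^bsub>quotient_module R J\<^esub> x = \<zero>\<^bsub>quotient_module R J\<^esub>"
        if "x \<in> carrier (quotient_module R J)" for x
        using that Q.l_neg Q.a_inv_closed by (auto simp: quotient_module_simps)
    qed (simp_all only: quotient_module_simps Q.a_assoc Q.a_closed Q.zero_closed Q.l_zero, rule Q.a_comm)
  qed (use assms(1) in \<open>auto simp: quotient_module_simps Q.l_distr Q.r_distr Q.m_assoc\<close>)
qed

section \<open>Polynomial rings\<close>

text \<open>Polynomials in the variables \<open>x\<^bsub>ij\<^esub>\<close>, indexed by pairs \<open>(i, j)\<close>: a monomial is a finitely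
  supported exponent function, a polynomial a finitely supported coefficient function.\<close>

type_synonym 'k mpoly = "((nat \<times> nat) \<Rightarrow>\<^sub>0 nat) \<Rightarrow>\<^sub>0 'k"

definition indet :: "nat \<Rightarrow> nat \<Rightarrow> 'k::field mpoly" where
  "indet i j = Poly_Mapping.single (Poly_Mapping.single (i, j) 1) 1"

text \<open>\<open>poly_ring m n\<close> is \<open>\<bbbK>[x\<^bsub>ij\<^esub> : i \<in> [m], j \<in> [n]]\<close>: only these variables may occur.\<close>

definition poly_ring :: "nat \<Rightarrow> nat \<Rightarrow> 'k::field mpoly ring" where
  "poly_ring m n =
     \<lparr>carrier = {p. \<forall>t \<in> Poly_Mapping.keys p.
                   Poly_Mapping.keys t \<subseteq> {1..m} \<times> {1..n}},
      mult = (*), one = 1, zero = 0, add = (+)\<rparr>"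

lemma poly_ring_cring: "cring (poly_ring m n :: 'k::field mpoly ring)"
proof (rule cringI)
  show "abelian_group (poly_ring m n :: 'k mpoly ring)"
  proof (rule abelian_groupI)
    show "\<exists>y\<in>carrier (poly_ring m n). y \<oplus>\<^bsub>poly_ring m n\<^esub> x = \<zero>\<^bsub>poly_ring m n\<^esub>"
      if "x \<in> carrier (poly_ring m n)" for x :: "'k mpoly"
      using that by (intro bexI[of _ "- x"]) (auto simp: poly_ring_def in_keys_iff)
  next
    fix x y :: "'k mpoly"
    assume "x \<in> carrier (poly_ring m n)" "y \<in> carrier (poly_ring m n)"
    then show "x \<oplus>\<^bsub>poly_ring m n\<^esub> y \<in> carrier (poly_ring m n)"
      using keys_add[of x y] unfolding poly_ring_def by fastforce
  qed (auto simp: poly_ring_def algebra_simps)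
next
  show "comm_monoid (poly_ring m n :: 'k mpoly ring)"
  proof (rule comm_monoidI)
    fix x y :: "'k mpoly"
    assume xy: "x \<in> carrier (poly_ring m n)" "y \<in> carrier (poly_ring m n)"
    have "Poly_Mapping.keys t \<subseteq> {1..m} \<times> {1..n}" if t: "t \<in> Poly_Mapping.keys (x * y)" for t
    proof -
      obtain a b where "t = a + b" "a \<in> Poly_Mapping.keys x" "b \<in> Poly_Mapping.keys y"
        using t keys_mult[of x y] by blast
      then show ?thesis
        using xy keys_add[of a b] unfolding poly_ring_def by fastforce
    qed
    then show "x \<otimes>\<^bsub>poly_ring m n\<^esub> y \<in> carrier (poly_ring m n)"
      by (simp add: poly_ring_def)
  qed (auto simp: poly_ring_def algebra_simps)
qed (auto simp: poly_ring_def algebra_simps)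

lemma indet_in_poly_ring:
  "i \<in> {1..m} \<Longrightarrow> j \<in> {1..n} \<Longrightarrow> indet i j \<in> carrier (poly_ring m n)"
  by (simp add: indet_def poly_ring_def)

definition graded_maximal_ideal :: "nat \<Rightarrow> nat \<Rightarrow> 'k::field mpoly set" where
  "graded_maximal_ideal m n =
     Idl\<^bsub>poly_ring m n\<^esub> {indet i j | i j. i \<in> {1..m} \<and> j \<in> {1..n}}"

section \<open>Generalized binomial edge ideals\<close>

text \<open>A simple graph on \<open>[n]\<close> is given by its set of edges, each a two-element subset of \<open>[n]\<close>.\<close>

definition gen_binomial_edge_ideal ::
  "nat \<Rightarrow> nat \<Rightarrow> nat set set \<Rightarrow> 'k::field mpoly set" where
  "gen_binomial_edge_ideal m n E =
     Idl\<^bsub>poly_ring m n\<^esub>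
       {indet i k * indet j l - indet i l * indet j k | i j k l.
          1 \<le> i \<and> i < j \<and> j \<le> m \<and> {k, l} \<in> E \<and> k < l}"

definition multipartite_part :: "(nat \<Rightarrow> nat) \<Rightarrow> nat \<Rightarrow> nat set" where
  "multipartite_part ns k = {1 + (\<Sum>j = 1..<k. ns j) .. (\<Sum>j = 1..k. ns j)}"

definition complete_multipartite_edges :: "nat \<Rightarrow> (nat \<Rightarrow> nat) \<Rightarrow> nat set set" where
  "complete_multipartite_edges r ns =
     {{u, v} | u v. \<exists>k \<in> {1..r}. \<exists>l \<in> {1..r}.
        k \<noteq> l \<and> u \<in> multipartite_part ns k \<and> v \<in> multipartite_part ns l}"

lemma multipartite_parts_disjoint:
  assumes "1 \<le> k" "k < l"
  shows "multipartite_part ns k \<inter> multipartite_part ns l = {}"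
proof -
  have "(\<Sum>j = 1..k. ns j) \<le> (\<Sum>j = 1..<l. ns j)"
    using assms by (intro sum_mono2) auto
  then show ?thesis by (auto simp: multipartite_part_def)
qed

lemma multipartite_parts_cover:
  "(\<Union>k \<in> {1..r}. multipartite_part ns k) = {1..(\<Sum>j = 1..r. ns j)}"
proof (induction r)
  case (Suc r)
  have "{1..Suc r} = insert (Suc r) {1..r}" by auto
  then have "(\<Union>k \<in> {1..Suc r}. multipartite_part ns k)
      = multipartite_part ns (Suc r) \<union> {1..(\<Sum>j = 1..r. ns j)}"
    using Suc by auto
  also have "\<dots> = {1..(\<Sum>j = 1..Suc r. ns j)}"
    by (auto simp: multipartite_part_def atLeastLessThanSuc_atLeastAtMost)
  finally show ?case .
qed simp

lemma complete_multipartite_edges_simple: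
  assumes "e \<in> complete_multipartite_edges r ns"
  shows "e \<subseteq> {1..(\<Sum>j = 1..r. ns j)} \<and> card e = 2"
proof -
  obtain u v k l where e: "e = {u, v}" and kl: "k \<in> {1..r}" "l \<in> {1..r}" "k \<noteq> l"
    and uv: "u \<in> multipartite_part ns k" "v \<in> multipartite_part ns l"
    using assms by (auto simp: complete_multipartite_edges_def)
  have "multipartite_part ns k \<inter> multipartite_part ns l = {}"
    using kl multipartite_parts_disjoint[of k l ns] multipartite_parts_disjoint[of l k ns]
    by (cases "k < l") auto
  then have "u \<noteq> v" using uv by auto
  moreover have "u \<in> {1..(\<Sum>j = 1..r. ns j)}" "v \<in> {1..(\<Sum>j = 1..r. ns j)}"
    using kl uv unfolding multipartite_parts_cover[symmetric] by blast+
  ultimately show ?thesis using e by auto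
qed

end

theory Submission
  imports Defs "HOL-Library.Product_Lexorder" "HOL-Library.Multiset"
begin

text \<open>
  Let \<open>P\<^sub>V\<close> be the ideal of the variables outside the columns of a part \<open>V\<close>, and \<open>I\<^sub>2\<close> the ideal
  of all 2-minors. Starting from \<open>I\<^sub>2\<close>, the edge ideal \<open>J\<close> is reached by intersecting with \<open>P\<^sub>V\<close>,
  one part \<open>V\<close> with at least two elements after the other, and at each step the sum of the two
  ideals is \<open>P\<^sub>V + I\<^sub>2\<close>, whose quotient is the determinantal ring of an \<open>m \<times> \<bar>V\<bar>\<close> matrix. On this
  ring the \<open>m + \<bar>V\<bar> - 1\<close> sums along the diagonals \<open>i + j = c\<close> form a regular sequence; summing
  further over the residue classes of \<open>c\<close> modulo \<open>D = m + n\<^sub>s - 1\<close> yields \<open>D\<close> elements that are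
  regular for all parts and for \<open>I\<^sub>2\<close> simultaneously. With one more element, regular on \<open>S/I\<^sub>2\<close> and
  on the rings \<open>S/P\<^sub>V\<close>, the exact sequences
  \<open>0 \<rightarrow> S/(Y \<inter> Z) \<rightarrow> S/Y \<oplus> S/Z \<rightarrow> S/(Y + Z) \<rightarrow> 0\<close> give a regular sequence of length \<open>D + 1\<close> on
  \<open>S/J\<close>. The same sequence for a part of size \<open>n\<^sub>s\<close> carries a socle element of the Artinian
  reduction of \<open>S/(P\<^sub>V + I\<^sub>2)\<close> to one of the reduction of \<open>S/J\<close>, and a Koszul-type complex shows
  that no regular sequence can then be longer.
\<close>

section \<open>Weakly regular sequences on quotients by ideals\<close>

text \<open>The length \<open>D\<close> is the dimension of the smallest of the rings
  \<open>S/(P_V + I_2)\<close>, so \<open>D\<close> elements are the most that can serve all of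
  them. One more element is possible because an element put last need not be regular on
  \<open>S/(Y + Z)\<close>: no further intersection is formed after it is adjoined. It only has to
  be nonzero on each of the domains that remain of the rings \<open>S/P_V\<close>. This last element
  is not homogeneous, so it is never permuted; all reorderings concern linear forms, for which the
  grading replaces Krull's intersection theorem. For the upper bound, Ext is replaced by cochains
  that admit every element of the maximal ideal as an argument, so that the cohomological
  characterization of depth follows from one contracting homotopy.\<close>

interpretation rid: Modules.module "(*) :: 'a \<Rightarrow> 'a \<Rightarrow> 'a::comm_ring_1"
  by unfold_locales (simp_all add: algebra_simps)

declare rid.scale_scale [simp del] \<comment> \<open>loops with \<open>mult.assoc\<close>\<close>

text \<open>The ring acts on itself by multiplication, so subspaces are ideals, spans are generated
  ideals, and the span calculus of \<open>Modules.module\<close> becomes available.\<close>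

abbreviation Ideal :: "'a::comm_ring_1 set \<Rightarrow> bool" where
  "Ideal \<equiv> rid.subspace"

abbreviation gen :: "'a::comm_ring_1 set \<Rightarrow> 'a set" where
  "gen \<equiv> rid.span"

definition adjoin :: "'a::comm_ring_1 set \<Rightarrow> 'a \<Rightarrow> 'a set" where
  "adjoin Y f = gen (insert f Y)"

abbreviation adjoin_list :: "'a::comm_ring_1 set \<Rightarrow> 'a list \<Rightarrow> 'a set" where
  "adjoin_list \<equiv> foldl adjoin"

definition nzd :: "'a::comm_ring_1 \<Rightarrow> 'a set \<Rightarrow> bool" where
  "nzd f Y \<longleftrightarrow> (\<forall>u. f * u \<in> Y \<longrightarrow> u \<in> Y)"

text \<open>Properness of the final ideal is left out: the sequences that count lie in the ideal
  generated by all variables, and \<open>1\<close> not being in that ideal restores it at the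
  end.\<close>

primrec reg :: "'a::comm_ring_1 set \<Rightarrow> 'a list \<Rightarrow> bool" where
  "reg Y [] \<longleftrightarrow> True"
| "reg Y (f # fs) \<longleftrightarrow> nzd f Y \<and> reg (adjoin Y f) fs"

definition ideal_sum :: "'a::comm_ring_1 set \<Rightarrow> 'a set \<Rightarrow> 'a set" where
  "ideal_sum Y Z = gen (Y \<union> Z)"

lemma Ideal_adjoin [simp]: "Ideal (adjoin Y f)"
  by (simp add: adjoin_def)

lemma Ideal_adjoin_list: "Ideal Y \<Longrightarrow> Ideal (adjoin_list Y fs)"
  by (induction fs arbitrary: Y) auto

lemma Ideal_ideal_sum [simp]: "Ideal (ideal_sum Y Z)"
  by (simp add: ideal_sum_def)

lemma Ideal_mult_right: "Ideal Y \<Longrightarrow> a \<in> Y \<Longrightarrow> a * c \<in> Y"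
  using rid.subspace_scale[of Y a c] by (simp add: mult.commute)

lemma Ideal_diff_iff: "Ideal Y \<Longrightarrow> x - y \<in> Y \<Longrightarrow> x \<in> Y \<longleftrightarrow> y \<in> Y"
  using rid.subspace_add[of Y "x - y" y] rid.subspace_diff[of Y x "x - y"] by auto

lemma adjoin_iff: "Ideal Y \<Longrightarrow> u \<in> adjoin Y f \<longleftrightarrow> (\<exists>k. u - k * f \<in> Y)"
  by (simp add: adjoin_def rid.span_breakdown_eq rid.span_eq_iff[THEN iffD2])

lemma adjoin_gen: "adjoin (gen B) f = gen (insert f B)"
proof -
  have "insert f (gen B) \<subseteq> gen (insert f B)"
    using rid.span_mono[of B "insert f B"] rid.span_base[of f "insert f B"] by auto
  moreover have "insert f B \<subseteq> gen (insert f (gen B))"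
    using rid.span_superset[of B] rid.span_superset[of "insert f (gen B)"] by auto
  ultimately show ?thesis unfolding adjoin_def by (simp add: rid.span_eq)
qed

lemma adjoin_superset: "Y \<subseteq> adjoin Y f"
  unfolding adjoin_def using rid.span_superset by blast

lemma adjoin_base: "f \<in> adjoin Y f"
  unfolding adjoin_def by (simp add: rid.span_base)

lemma adjoin_mono: "Y \<subseteq> Z \<Longrightarrow> adjoin Y f \<subseteq> adjoin Z f"
  unfolding adjoin_def by (intro rid.span_mono) auto

lemma adjoin_least: "Y \<subseteq> Z \<Longrightarrow> f \<in> Z \<Longrightarrow> Ideal Z \<Longrightarrow> adjoin Y f \<subseteq> Z"
  unfolding adjoin_def by (intro rid.span_minimal) auto

lemma adjoin_list_gen: "adjoin_list (gen B) fs = gen (set fs \<union> B)"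
proof (induction fs arbitrary: B)
  case (Cons f fs)
  have "set fs \<union> insert f B = set (f # fs) \<union> B" by auto
  then show ?case using Cons[of "insert f B"] by (simp add: adjoin_gen)
qed simp

lemma adjoin_list_eq: "Ideal Y \<Longrightarrow> adjoin_list Y fs = gen (set fs \<union> Y)"
  using adjoin_list_gen[of Y fs] by (simp add: rid.span_eq_iff[THEN iffD2])

lemma adjoin_list_superset: "Ideal Y \<Longrightarrow> Y \<subseteq> adjoin_list Y fs"
  by (simp add: adjoin_list_eq) (use rid.span_superset in blast)

lemma adjoin_list_base: "Ideal Y \<Longrightarrow> f \<in> set fs \<Longrightarrow> f \<in> adjoin_list Y fs"
  by (simp add: adjoin_list_eq rid.span_base)

lemma adjoin_cong:
  assumes "Ideal Y" "f - g \<in> Y"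
  shows "adjoin Y f = adjoin Y g"
proof -
  have *: "adjoin Y f \<subseteq> adjoin Y g" if "f - g \<in> Y" for f g
  proof (rule adjoin_least)
    show "Y \<subseteq> adjoin Y g" by (rule adjoin_superset)
    have "f - g \<in> adjoin Y g" using that adjoin_superset by blast
    then show "f \<in> adjoin Y g" using adjoin_base[of g Y] Ideal_adjoin Ideal_diff_iff by blast
  qed simp
  have "g - f \<in> Y" using rid.subspace_neg[OF assms] by simp
  with * assms show ?thesis by blast
qed

lemma nzd_cong:
  assumes "Ideal Y" "f - g \<in> Y"
  shows "nzd f Y \<longleftrightarrow> nzd g Y"
proof -
  have "f * u \<in> Y \<longleftrightarrow> g * u \<in> Y" for u
    using Ideal_diff_iff[OF assms(1), of "f * u" "g * u"] Ideal_mult_right[OF assms, of u]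
    by (simp add: left_diff_distrib)
  then show ?thesis by (simp add: nzd_def)
qed

lemma reg_append: "reg Y (fs @ gs) \<longleftrightarrow> reg Y fs \<and> reg (adjoin_list Y fs) gs"
  by (induction fs arbitrary: Y) auto

text \<open>Congruences modulo \<open>Y\<close> survive each step because the ideals only grow along
  the sequence. This trades diagonal sums for cyclic ones, and polynomials for their images in the
  smaller ring.\<close>

lemma reg_cong:
  assumes "Ideal Y" "list_all2 (\<lambda>a b. a - b \<in> Y) fs gs" "reg Y fs"
  shows "reg Y gs"
  using assms
proof (induction fs arbitrary: Y gs)
  case (Cons x xs)
  then obtain y ys where gs: "gs = y # ys" and y: "x - y \<in> Y"
    and ys: "list_all2 (\<lambda>a b. a - b \<in> Y) xs ys"
    by (auto simp: list_all2_Cons1)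
  have "list_all2 (\<lambda>a b. a - b \<in> adjoin Y x) xs ys"
    using ys by (rule list_all2_mono) (rule subsetD[OF adjoin_superset])
  from Cons.IH[OF Ideal_adjoin this] have "reg (adjoin Y x) ys"
    using Cons.prems(3) by simp
  then show ?case
    using adjoin_cong[OF Cons.prems(1) y] nzd_cong[OF Cons.prems(1) y] Cons.prems(3) gs by simp
qed simp

lemma reg_iff_nth:
  "reg (gen B) fs \<longleftrightarrow>
     (\<forall>i < length fs. \<forall>u. fs ! i * u \<in> gen (set (take i fs) \<union> B) \<longrightarrow> u \<in> gen (set (take i fs) \<union> B))"
proof (induction fs rule: rev_induct)
  case (snoc f fs)
  have "reg (gen B) (fs @ [f]) \<longleftrightarrow> reg (gen B) fs \<and> nzd f (gen (set fs \<union> B))"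
    by (simp add: reg_append adjoin_list_gen)
  then show ?case unfolding snoc by (auto simp: nzd_def nth_append less_Suc_eq)
qed simp

lemma adjoin_commute: "adjoin (adjoin Y f) g = adjoin (adjoin Y g) f"
  by (simp only: adjoin_def[of Y] adjoin_gen insert_commute[of f g])

text \<open>The second assumption says that the ideals \<open>Y + (f^k)\<close> intersect in
  \<open>Y\<close>, as Krull's theorem gives in the local case. If \<open>g * u\<close> lies in
  \<open>Y\<close>, then \<open>u\<close> is \<open>f * v\<close> modulo \<open>Y\<close> with
  \<open>g * v\<close> again in \<open>Y\<close>; iterating puts \<open>u\<close> in every
  \<open>Y + (f^k)\<close>.\<close>

lemma nzd_swap:
  assumes Y: "Ideal Y" and "\<And>u. (\<And>k. \<exists>v. u - f ^ k * v \<in> Y) \<Longrightarrow> u \<in> Y"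
    and "nzd f Y" "nzd g (adjoin Y f)"
  shows "nzd g Y" and "nzd f (adjoin Y g)"
proof -
  have step: "\<exists>v. u - f * v \<in> Y \<and> g * v \<in> Y" if u: "g * u \<in> Y" for u
  proof -
    have "g * u \<in> adjoin Y f" using u adjoin_superset[of Y f] by blast
    then have "u \<in> adjoin Y f" using assms(4) by (simp add: nzd_def)
    then obtain v where "u - v * f \<in> Y" using adjoin_iff[OF Y, of u f] by auto
    then have v: "u - f * v \<in> Y" by (simp add: mult.commute)
    have "f * (g * v) = g * u - g * (u - f * v)" by (simp add: algebra_simps)
    then have "f * (g * v) \<in> Y"
      using rid.subspace_diff[OF Y u rid.subspace_scale[OF Y v, of g]] by (simp only:)
    then have "g * v \<in> Y" using assms(3) by (simp add: nzd_def)
    then show ?thesis using v by blast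
  qed
  have "\<exists>v. u - f ^ k * v \<in> Y \<and> g * v \<in> Y" if u: "g * u \<in> Y" for u k
  proof (induction k)
    case 0
    show ?case using u rid.subspace_0[OF Y] by (intro exI[of _ u]) simp
  next
    case (Suc k)
    then obtain v w where v: "u - f ^ k * v \<in> Y" and w: "v - f * w \<in> Y" "g * w \<in> Y"
      using step by blast
    have "u - f ^ Suc k * w = (u - f ^ k * v) + f ^ k * (v - f * w)"
      by (simp add: algebra_simps)
    then have "u - f ^ Suc k * w \<in> Y"
      using rid.subspace_add[OF Y v rid.subspace_scale[OF Y w(1), of "f ^ k"]] by (simp only:)
    then show ?case using w(2) by blast
  qed
  then show g: "nzd g Y"
    unfolding nzd_def by (intro allI impI assms(2)) blast
  show "nzd f (adjoin Y g)"
    unfolding nzd_def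
  proof (intro allI impI)
    fix u assume "f * u \<in> adjoin Y g"
    then obtain a where a: "f * u - a * g \<in> Y" using adjoin_iff[OF Y, of "f * u" g] by auto
    have "g * a = u * f - (f * u - a * g)" by (simp add: algebra_simps)
    then have "g * a \<in> adjoin Y f"
      using rid.subspace_diff[OF Ideal_adjoin rid.subspace_scale[OF Ideal_adjoin adjoin_base, of u f Y]
          subsetD[OF adjoin_superset a]] by (simp only:)
    then have "a \<in> adjoin Y f" using assms(4) by (simp add: nzd_def)
    then obtain b where b: "a - b * f \<in> Y" using adjoin_iff[OF Y, of a f] by auto
    have "f * (u - b * g) = (f * u - a * g) + g * (a - b * f)" by (simp add: algebra_simps)
    then have "f * (u - b * g) \<in> Y"
      using rid.subspace_add[OF Y a rid.subspace_scale[OF Y b, of g]] by (simp only:)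
    then have "u - b * g \<in> Y" using assms(3) by (simp add: nzd_def)
    then show "u \<in> adjoin Y g" using adjoin_iff[OF Y, of u g] by auto
  qed
qed

text \<open>The facts on \<open>Y \<inter> Z\<close> below express the exactness of
  \<open>0 \<rightarrow> R/(Y \<inter> Z) \<rightarrow> R/Y \<oplus> R/Z \<rightarrow> R/(Y + Z) \<rightarrow> 0\<close>.\<close>

lemma ideal_sum_iff: "Ideal Y \<Longrightarrow> Ideal Z \<Longrightarrow> u \<in> ideal_sum Y Z \<longleftrightarrow> (\<exists>y\<in>Y. \<exists>z\<in>Z. u = y + z)"
  unfolding ideal_sum_def rid.span_Un using rid.span_eq_iff[of Y] rid.span_eq_iff[of Z] by blast

lemma adjoin_ideal_sum: "Ideal Y \<Longrightarrow> Ideal Z \<Longrightarrow> ideal_sum (adjoin Y f) (adjoin Z f) = adjoin (ideal_sum Y Z) f"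
proof -
  assume *: "Ideal Y" "Ideal Z"
  have "adjoin Y f \<subseteq> adjoin (ideal_sum Y Z) f" "adjoin Z f \<subseteq> adjoin (ideal_sum Y Z) f"
    unfolding ideal_sum_def using rid.span_superset[of "Y \<union> Z"] by (auto intro!: adjoin_mono)
  then have "ideal_sum (adjoin Y f) (adjoin Z f) \<subseteq> adjoin (ideal_sum Y Z) f"
    unfolding ideal_sum_def[of "adjoin _ _"] by (intro rid.span_minimal) auto
  moreover have "adjoin (ideal_sum Y Z) f \<subseteq> ideal_sum (adjoin Y f) (adjoin Z f)"
  proof (rule adjoin_least)
    show "ideal_sum Y Z \<subseteq> ideal_sum (adjoin Y f) (adjoin Z f)"
      unfolding ideal_sum_def using adjoin_superset[of Y f] adjoin_superset[of Z f] by (intro rid.span_mono) auto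
    show "f \<in> ideal_sum (adjoin Y f) (adjoin Z f)"
      unfolding ideal_sum_def by (intro rid.span_base) (simp add: adjoin_base)
  qed simp
  ultimately show ?thesis by blast
qed

lemma adjoin_Int:
  assumes "Ideal Y" "Ideal Z" "nzd f (ideal_sum Y Z)"
  shows "adjoin (Y \<inter> Z) f = adjoin Y f \<inter> adjoin Z f"
proof
  show "adjoin (Y \<inter> Z) f \<subseteq> adjoin Y f \<inter> adjoin Z f"
    by (simp add: adjoin_mono)
  show "adjoin Y f \<inter> adjoin Z f \<subseteq> adjoin (Y \<inter> Z) f"
  proof
    fix u assume "u \<in> adjoin Y f \<inter> adjoin Z f"
    then obtain a b where ab: "u - a * f \<in> Y" "u - b * f \<in> Z"
      using assms adjoin_iff by blast
    have "f * (b - a) = (u - a * f) + - (u - b * f)" by (simp add: algebra_simps)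
    then have "f * (b - a) \<in> ideal_sum Y Z"
      using ab assms rid.subspace_neg[OF assms(2)] unfolding ideal_sum_iff[OF assms(1,2)] by blast
    then have "b - a \<in> ideal_sum Y Z" using assms(3) by (simp add: nzd_def)
    then obtain y z where yz: "y \<in> Y" "z \<in> Z" "b - a = y + z"
      using ideal_sum_iff[OF assms(1,2)] by blast
    \<comment> \<open>Moving \<open>y\<close> to \<open>a\<close> and \<open>z\<close> to
      \<open>b\<close> turns the two multipliers of \<open>f\<close> into a single one that works
      for both ideals.\<close>
    have eq: "b - z = a + y" using yz(3) by (simp add: algebra_simps)
    have "u - (a + y) * f = (u - a * f) - y * f" by (simp add: algebra_simps)
    then have 1: "u - (a + y) * f \<in> Y"
      using ab yz assms(1) by (simp only: rid.subspace_diff Ideal_mult_right)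
    have "u - (b - z) * f = (u - b * f) + z * f" by (simp add: algebra_simps)
    then have "u - (b - z) * f \<in> Z"
      using ab yz assms(2) by (simp only: rid.subspace_add Ideal_mult_right)
    then have 2: "u - (a + y) * f \<in> Z" using eq by simp
    have "Ideal (Y \<inter> Z)" using assms rid.subspace_inter by blast
    then show "u \<in> adjoin (Y \<inter> Z) f" using 1 2 adjoin_iff by blast
  qed
qed

lemma nzd_Int: "nzd f Y \<Longrightarrow> nzd f Z \<Longrightarrow> nzd f (Y \<inter> Z)"
  by (simp add: nzd_def)

lemma adjoin_list_Int:
  assumes "Ideal Y" "Ideal Z" "reg (ideal_sum Y Z) fs"
  shows "adjoin_list (Y \<inter> Z) fs = adjoin_list Y fs \<inter> adjoin_list Z fs \<and> ideal_sum (adjoin_list Y fs) (adjoin_list Z fs) = adjoin_list (ideal_sum Y Z) fs"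
  using assms
proof (induction fs arbitrary: Y Z)
  case (Cons f fs)
  then have f: "nzd f (ideal_sum Y Z)" and fs: "reg (ideal_sum (adjoin Y f) (adjoin Z f)) fs"
    by (simp_all add: adjoin_ideal_sum)
  show ?case using Cons.IH[OF Ideal_adjoin Ideal_adjoin fs] Cons.prems(1,2) f by (simp add: adjoin_Int adjoin_ideal_sum)
qed simp_all

text \<open>Adjoining an element of \<open>fs\<close> commutes with the intersection because the
  element is regular on the sum (\<open>adjoin_Int\<close>). For \<open>f\<close> this is not
  demanded, since nothing follows it; so the sequence can be longer by one than any on the
  sum.\<close>

lemma reg_Int:
  assumes "Ideal Y" "Ideal Z" "reg Y (fs @ [f])" "reg Z (fs @ [f])" "reg (ideal_sum Y Z) fs"
  shows "reg (Y \<inter> Z) (fs @ [f])"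
  using assms
proof (induction fs arbitrary: Y Z)
  case (Cons g fs)
  have "reg (adjoin Y g \<inter> adjoin Z g) (fs @ [f])"
    using Cons.prems by (intro Cons.IH) (auto simp: adjoin_ideal_sum)
  then show ?case using Cons.prems by (simp add: nzd_Int adjoin_Int)
qed (simp add: nzd_Int)

text \<open>Socle elements are transported along the connecting map of the same sequence.\<close>

lemma socle_Int:
  assumes YZ: "Ideal Y" "Ideal Z" and f: "nzd f Y" "nzd f Z" "f \<in> I"
    and u: "u \<notin> ideal_sum Y Z" "\<forall>a\<in>I. a * u \<in> ideal_sum Y Z"
  shows "\<exists>w. w \<notin> adjoin (Y \<inter> Z) f \<and> (\<forall>a\<in>I. a * w \<in> adjoin (Y \<inter> Z) f)"
proof -
  have id: "Ideal (Y \<inter> Z)" using YZ rid.subspace_inter by blast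
  \<comment> \<open>Snake lemma: \<open>w\<close> is \<open>f * u\<close> modulo \<open>Y\<close>
    and \<open>0\<close> modulo \<open>Z\<close>, so it represents \<open>f\<close> times the lift
    \<open>(u, 0)\<close> of \<open>u\<close>.\<close>
  obtain y w where w: "y \<in> Y" "w \<in> Z" "f * u = y + w"
    using u(2) f(3) ideal_sum_iff[OF YZ] by blast
  have "w \<notin> adjoin (Y \<inter> Z) f"
  proof
    assume "w \<in> adjoin (Y \<inter> Z) f"
    then obtain v where v: "w - v * f \<in> Y" "w - v * f \<in> Z"
      using adjoin_iff[OF id] by auto
    have "f * (u - v) = y + (w - v * f)" using w(3) by (simp add: algebra_simps)
    then have "f * (u - v) \<in> Y" using rid.subspace_add[OF YZ(1) w(1) v(1)] by simp
    then have "u - v \<in> Y" using f(1) by (simp add: nzd_def)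
    moreover have "f * v \<in> Z" using rid.subspace_diff[OF YZ(2) w(2) v(2)] by (simp add: mult.commute)
    then have "v \<in> Z" using f(2) by (simp add: nzd_def)
    moreover have "u = (u - v) + v" by simp
    ultimately show False using u(1) ideal_sum_iff[OF YZ] by blast
  qed
  moreover have "a * w \<in> adjoin (Y \<inter> Z) f" if a: "a \<in> I" for a
  proof -
    have "a * u \<in> ideal_sum Y Z" using u(2) a by blast
    then obtain b c where bc: "b \<in> Y" "c \<in> Z" "a * u = b + c"
      unfolding ideal_sum_iff[OF YZ] by blast
    have "a * (y + w) = f * (b + c)"
      by (simp only: w(3)[symmetric] bc(3)[symmetric] mult.left_commute)
    then have "a * w - c * f = f * b - a * y"
      by (simp add: algebra_simps)
    then have "a * w - c * f \<in> Y"
      using rid.subspace_diff[OF YZ(1) rid.subspace_scale[OF YZ(1) bc(1), of f]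
        rid.subspace_scale[OF YZ(1) w(1), of a]] by simp
    moreover have "a * w - c * f \<in> Z"
      using rid.subspace_diff[OF YZ(2) rid.subspace_scale[OF YZ(2) w(2), of a]
        Ideal_mult_right[OF YZ(2) bc(2), of f]] .
    ultimately show ?thesis using adjoin_iff[OF id] by blast
  qed
  ultimately show ?thesis by blast
qed

text \<open>A complex of cochains on lists of elements of \<open>I\<close>, graded by length. The recursive form
  of the differential makes \<open>c \<mapsto> c(f, \<dots>)\<close> a homotopy that contracts multiplication by \<open>f\<close>.\<close>

fun cobd :: "('a::comm_ring_1 list \<Rightarrow> 'a) \<Rightarrow> 'a list \<Rightarrow> 'a" where
  "cobd c [] = 0"
| "cobd c (a # v) = a * c v - cobd (\<lambda>w. c (a # w)) v"

lemma cobd_diff: "cobd (\<lambda>w. b w - c w) v = cobd b v - cobd c v"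
  by (induction v arbitrary: b c) (simp_all add: right_diff_distrib)

lemma cobd_mult: "cobd (\<lambda>w. x * c w) v = x * cobd c v"
  by (induction v arbitrary: c) (simp_all add: right_diff_distrib mult.left_commute)

lemma cobd_cobd: "cobd (cobd c) v = 0"
proof (induction v arbitrary: c)
  case (Cons a v)
  have "cobd (\<lambda>w. cobd c (a # w)) v = a * cobd c v"
    using Cons by (simp add: cobd_diff cobd_mult)
  then show ?case by simp
qed simp

definition cochains :: "'a set \<Rightarrow> nat \<Rightarrow> 'a list set" where
  "cochains I i = {v \<in> lists I. length v = i}"

text \<open>Vanishing of the \<open>i\<close>-th cohomology with coefficients in the quotient by
  \<open>Y\<close>. Cochains need not be alternating and every element of \<open>I\<close> may be an
  entry, so no generating set is chosen. As \<open>cobd b []\<close> is \<open>0\<close>, the case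
  \<open>i = 0\<close> says that no nonzero class is annihilated by \<open>I\<close>.\<close>

definition vanish :: "'a::comm_ring_1 set \<Rightarrow> nat \<Rightarrow> 'a set \<Rightarrow> bool" where
  "vanish I i Y \<longleftrightarrow> (\<forall>c. (\<forall>v\<in>cochains I (Suc i). cobd c v \<in> Y) \<longrightarrow>
     (\<exists>b. \<forall>v\<in>cochains I i. c v - cobd b v \<in> Y))"

lemma cobd_in:
  assumes "Ideal Y" "\<forall>v\<in>cochains I i. c v \<in> Y" "v \<in> cochains I (Suc i)"
  shows "cobd c v \<in> Y"
  using assms(2,3)
proof (induction i arbitrary: c v)
  case 0
  then obtain a where "v = [a]" by (auto simp: cochains_def length_Suc_conv)
  with 0 assms(1) show ?case by (simp add: cochains_def rid.subspace_scale)
next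
  case (Suc i)
  then obtain a w where v: "v = a # w" "a \<in> I" "w \<in> cochains I (Suc i)"
    by (cases v) (auto simp: cochains_def)
  have "cobd (\<lambda>w. c (a # w)) w \<in> Y"
    using Suc.prems(1) v by (intro Suc.IH) (auto simp: cochains_def)
  moreover have "a * c w \<in> Y" using Suc.prems(1) v(3) assms(1) rid.subspace_scale by blast
  ultimately show ?case unfolding v(1) using assms(1) by (simp only: cobd.simps rid.subspace_diff)
qed

lemma vanish_0_iff: "vanish I 0 Y \<longleftrightarrow> (\<forall>u. (\<forall>a\<in>I. a * u \<in> Y) \<longrightarrow> u \<in> Y)"
proof -
  have 0: "cochains I 0 = {[]}" by (auto simp: cochains_def)
  have 1: "cochains I (Suc 0) = (\<lambda>a. [a]) ` I" by (auto simp: cochains_def length_Suc_conv)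
  show ?thesis unfolding vanish_def 0 1 by (auto dest: spec[of _ "\<lambda>_. _"])
qed

text \<open>In the long exact sequence of \<open>0 -> R/Y -> R/Y -> R/(Y, f) -> 0\<close> the
  homotopy makes \<open>f\<close> act as zero on cohomology, so \<open>H^i(R/(Y, f))\<close> maps
  onto \<open>H^(i+1)(R/Y)\<close>.\<close>

lemma vanish_up:
  assumes Y: "Ideal Y" and f: "f \<in> I" "nzd f Y" and van: "vanish I i (adjoin Y f)"
  shows "vanish I (Suc i) Y"
  unfolding vanish_def
proof (intro allI impI)
  fix c assume c: "\<forall>v\<in>cochains I (Suc (Suc i)). cobd c v \<in> Y"
  define h where "h = (\<lambda>w. c (f # w))"
  have homotopy: "f * c v - cobd h v \<in> Y" if "v \<in> cochains I (Suc i)" for v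
    using c[rule_format, of "f # v"] that f(1) by (auto simp: cochains_def h_def)
  have "\<forall>v\<in>cochains I (Suc i). cobd h v \<in> adjoin Y f"
  proof
    fix v assume v: "v \<in> cochains I (Suc i)"
    have "cobd h v - c v * f = - (f * c v - cobd h v)" by (simp add: algebra_simps)
    then show "cobd h v \<in> adjoin Y f"
      using homotopy[OF v] Y rid.subspace_neg adjoin_iff[OF Y] by metis
  qed
  then obtain b where "\<forall>v\<in>cochains I i. h v - cobd b v \<in> adjoin Y f"
    using van unfolding vanish_def by blast
  then have "\<forall>v\<in>cochains I i. \<exists>k. h v - cobd b v - k * f \<in> Y"
    using adjoin_iff[OF Y] by blast
  then obtain e where e: "\<And>v. v \<in> cochains I i \<Longrightarrow> h v - cobd b v - e v * f \<in> Y"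
    by metis
  have "c v - cobd e v \<in> Y" if v: "v \<in> cochains I (Suc i)" for v
  proof -
    have "cobd (\<lambda>w. h w - cobd b w - f * e w) v \<in> Y"
      using e by (intro cobd_in[OF Y _ v]) (simp add: mult.commute)
    then have "cobd h v - f * cobd e v \<in> Y"
      by (simp add: cobd_diff cobd_cobd cobd_mult)
    with homotopy[OF v] have "(f * c v - cobd h v) + (cobd h v - f * cobd e v) \<in> Y"
      using Y rid.subspace_add by blast
    then have "f * (c v - cobd e v) \<in> Y" by (simp add: algebra_simps)
    then show ?thesis using f(2) by (simp add: nzd_def)
  qed
  then show "\<exists>b. \<forall>v\<in>cochains I (Suc i). c v - cobd b v \<in> Y" by blast
qed

text \<open>In the same long exact sequence, \<open>H^i(R/(Y, f))\<close> sits between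
  \<open>H^i(R/Y)\<close> and \<open>H^(i+1)(R/Y)\<close>.\<close>

lemma vanish_down:
  assumes Y: "Ideal Y" and f: "nzd f Y" and van: "vanish I i Y" "vanish I (Suc i) Y"
  shows "vanish I i (adjoin Y f)"
  unfolding vanish_def
proof (intro allI impI)
  fix c assume "\<forall>v\<in>cochains I (Suc i). cobd c v \<in> adjoin Y f"
  then have "\<forall>v\<in>cochains I (Suc i). \<exists>k. cobd c v - k * f \<in> Y"
    using adjoin_iff[OF Y] by blast
  \<comment> \<open>Modulo \<open>Y\<close> the coboundary of \<open>c\<close> is
    \<open>f * e\<close>; \<open>e\<close> represents the image of \<open>c\<close> under the
    connecting map.\<close>
  then obtain e where e: "\<And>v. v \<in> cochains I (Suc i) \<Longrightarrow> cobd c v - e v * f \<in> Y"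
    by metis
  have "cobd e v \<in> Y" if v: "v \<in> cochains I (Suc (Suc i))" for v
  proof -
    have "cobd (\<lambda>w. cobd c w - f * e w) v \<in> Y"
      using e by (intro cobd_in[OF Y _ v]) (simp add: mult.commute)
    then have "- (f * cobd e v) \<in> Y" by (simp add: cobd_diff cobd_cobd cobd_mult)
    then have "f * cobd e v \<in> Y" using rid.subspace_neg[OF Y] by fastforce
    then show ?thesis using f by (simp add: nzd_def)
  qed
  then obtain b where b: "\<And>v. v \<in> cochains I (Suc i) \<Longrightarrow> e v - cobd b v \<in> Y"
    using van(2) unfolding vanish_def by blast
  have "cobd (\<lambda>w. c w - f * b w) v \<in> Y" if v: "v \<in> cochains I (Suc i)" for v
  proof -
    have "(cobd c v - e v * f) + f * (e v - cobd b v) \<in> Y"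
      using e[OF v] b[OF v] Y by (simp add: rid.subspace_add rid.subspace_scale)
    then show ?thesis by (simp add: cobd_diff cobd_mult algebra_simps)
  qed
  then obtain g where g: "\<forall>v\<in>cochains I i. c v - f * b v - cobd g v \<in> Y"
    using van(1) unfolding vanish_def by blast
  have "c v - cobd g v \<in> adjoin Y f" if "v \<in> cochains I i" for v
  proof -
    have "c v - cobd g v - b v * f \<in> Y"
      using g that by (simp add: algebra_simps)
    then show ?thesis using adjoin_iff[OF Y] by blast
  qed
  then show "\<exists>b. \<forall>v\<in>cochains I i. c v - cobd b v \<in> adjoin Y f" by blast
qed

lemma vanish_of_reg:
  assumes "Ideal Y" "set gs \<subseteq> I" "reg Y gs" "i < length gs"
  shows "vanish I i Y"
  using assms
proof (induction gs arbitrary: Y i)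
  case (Cons g gs)
  show ?case
  proof (cases i)
    case 0
    show ?thesis unfolding 0 vanish_0_iff using Cons.prems by (auto simp: nzd_def)
  next
    case (Suc j)
    have "vanish I j (adjoin Y g)" using Cons.prems Suc by (intro Cons.IH) auto
    then show ?thesis using Cons.prems Suc vanish_up by auto
  qed
qed simp

lemma vanish_adjoin_list:
  assumes "Ideal Y" "reg Y fs" "\<And>i. i \<le> length fs \<Longrightarrow> vanish I i Y"
  shows "vanish I 0 (adjoin_list Y fs)"
  using assms
proof (induction fs arbitrary: Y)
  case (Cons f fs)
  have "vanish I i (adjoin Y f)" if "i \<le> length fs" for i
    using Cons.prems that by (intro vanish_down) auto
  with Cons.IH[OF Ideal_adjoin] have "vanish I 0 (adjoin_list (adjoin Y f) fs)" using Cons.prems(2) by simp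
  then show ?case by simp
qed simp

text \<open>Takes the place of the theorem that all maximal regular sequences in \<open>I\<close>
  have the same length. A longer \<open>gs\<close> would make the cohomology of \<open>R/Y\<close>
  vanish up to degree \<open>length fs\<close>; dividing by \<open>fs\<close> brings this down to
  degree 0, where the socle element \<open>u\<close> contradicts it.\<close>

lemma regular_length_le:
  assumes "Ideal Y" "reg Y fs"
    and socle: "u \<notin> adjoin_list Y fs" "\<forall>a\<in>I. a * u \<in> adjoin_list Y fs"
    and "set gs \<subseteq> I" "reg Y gs"
  shows "length gs \<le> length fs"
proof (rule ccontr)
  assume "\<not> length gs \<le> length fs"
  then have "vanish I 0 (adjoin_list Y fs)"
    using assms by (intro vanish_adjoin_list) (auto intro!: vanish_of_reg)
  then show False using socle by (simp add: vanish_0_iff)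
qed

section \<open>Substitutions in polynomials\<close>

abbreviation cst :: "'k::field \<Rightarrow> 'k mpoly" where
  "cst c \<equiv> Poly_Mapping.single 0 c"

definition X :: "nat \<times> nat \<Rightarrow> 'k::field mpoly" where
  "X v = Poly_Mapping.single (Poly_Mapping.single v 1) 1"

lemma indet_eq: "indet i j = X (i, j)"
  by (simp add: indet_def X_def)

lemma mpoly_eq_sum:
  "(\<Sum>t\<in>Poly_Mapping.keys p. Poly_Mapping.single t (Poly_Mapping.lookup p t)) = p"
proof (rule poly_mapping_eqI)
  fix s
  have "Poly_Mapping.lookup (\<Sum>t\<in>Poly_Mapping.keys p. Poly_Mapping.single t (Poly_Mapping.lookup p t)) s
      = (\<Sum>t\<in>Poly_Mapping.keys p. if t = s then Poly_Mapping.lookup p t else 0)"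
    by (simp add: lookup_sum lookup_single when_def)
  also have "\<dots> = Poly_Mapping.lookup p s"
    by (simp add: sum.delta' in_keys_iff)
  finally show "Poly_Mapping.lookup (\<Sum>t\<in>Poly_Mapping.keys p.
      Poly_Mapping.single t (Poly_Mapping.lookup p t)) s = Poly_Mapping.lookup p s" .
qed

lemma poly_mapping_term_induct [case_names single add]:
  fixes p :: "'a \<Rightarrow>\<^sub>0 'b::comm_monoid_add"
  assumes "\<And>t c. P (Poly_Mapping.single t c)" "\<And>p q. P p \<Longrightarrow> P q \<Longrightarrow> P (p + q)"
  shows "P p"
proof -
  have "P 0" using assms(1)[of undefined 0] by simp
  then have "P (\<Sum>t\<in>A. Poly_Mapping.single t (Poly_Mapping.lookup p t))" for A
    by (induction A rule: infinite_finite_induct) (simp_all add: assms)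
  from this[of "Poly_Mapping.keys p"] show ?thesis by (simp only: mpoly_eq_sum)
qed

lemma mpoly_induct [case_names const var add mult]:
  fixes p :: "'k::field mpoly"
  assumes const: "\<And>c. P (cst c)" and var: "\<And>v. P (X v)"
    and add: "\<And>p q. P p \<Longrightarrow> P q \<Longrightarrow> P (p + q)" and mult: "\<And>p q. P p \<Longrightarrow> P q \<Longrightarrow> P (p * q)"
  shows "P p"
proof (induction p rule: poly_mapping_term_induct)
  case (single t c)
  have pow: "P (Poly_Mapping.single (Poly_Mapping.single v k) 1)" for v k
  proof (induction k)
    case 0
    show ?case using const[of 1] by simp
  next
    case (Suc k)
    have "Poly_Mapping.single v (Suc k) = Poly_Mapping.single v 1 + Poly_Mapping.single v k"
      by (simp flip: single_add)
    then have "Poly_Mapping.single (Poly_Mapping.single v (Suc k)) 1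
        = (X v :: 'k mpoly) * Poly_Mapping.single (Poly_Mapping.single v k) 1"
      by (simp add: mult_single X_def)
    then show ?case using mult[OF var Suc] by (simp add: X_def)
  qed
  have "P (Poly_Mapping.single t 1)"
  proof (induction t rule: poly_mapping_term_induct)
    case (add s t)
    have "Poly_Mapping.single (s + t) 1 = Poly_Mapping.single s (1::'k) * Poly_Mapping.single t 1"
      by (simp add: mult_single)
    then show ?case using mult[OF add] by simp
  qed (rule pow)
  from mult[OF const[of c] this] show ?case by (simp add: mult_single)
qed (rule add)

definition monoid_map :: "(((nat \<times> nat) \<Rightarrow>\<^sub>0 nat) \<Rightarrow> 'k::field mpoly) \<Rightarrow> bool" where
  "monoid_map f \<longleftrightarrow> f 0 = 1 \<and> (\<forall>s t. f (s + t) = f s * f t)"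

text \<open>Linear extension from monomials, multiplicative if \<open>f\<close> is a monoid map. It
  serves substitutions, the parametrization of rank one matrices, and also homogeneous components,
  where it is not multiplicative.\<close>

definition lift :: "(((nat \<times> nat) \<Rightarrow>\<^sub>0 nat) \<Rightarrow> 'k::field mpoly) \<Rightarrow> 'k mpoly \<Rightarrow> 'k mpoly" where
  "lift f p = (\<Sum>t\<in>Poly_Mapping.keys p. cst (Poly_Mapping.lookup p t) * f t)"

lemma lift_superset:
  assumes "finite A" "Poly_Mapping.keys p \<subseteq> A"
  shows "lift f p = (\<Sum>t\<in>A. cst (Poly_Mapping.lookup p t) * f t)"
  unfolding lift_def using assms by (intro sum.mono_neutral_left) (auto simp: in_keys_iff)

lemma lift_add: "lift f (p + q) = lift f p + lift f q"
proof -
  let ?A = "Poly_Mapping.keys p \<union> Poly_Mapping.keys q"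
  have "lift f (p + q) = (\<Sum>t\<in>?A. cst (Poly_Mapping.lookup (p + q) t) * f t)"
    using keys_add[of p q] by (intro lift_superset) auto
  also have "\<dots> = lift f p + lift f q"
    by (subst (1 2) lift_superset[of ?A]) (auto simp: lookup_add single_add distrib_right sum.distrib)
  finally show ?thesis .
qed

lemma lift_single: "lift f (Poly_Mapping.single t c) = cst c * f t"
  by (simp add: lift_def)

lemma lift_0 [simp]: "lift f 0 = 0"
  by (simp add: lift_def)

lemma lift_mult: "monoid_map f \<Longrightarrow> lift f (p * q) = lift f p * lift f q"
proof (induction p rule: poly_mapping_term_induct)
  case (single s a)
  then show ?case
  proof (induction q rule: poly_mapping_term_induct)
    case (single t b)
    have "cst (a * b) = cst a * cst b" by (simp add: mult_single)
    moreover have "f (s + t) = f s * f t" using single by (simp add: monoid_map_def)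
    moreover have "lift f (Poly_Mapping.single s a * Poly_Mapping.single t b) = cst (a * b) * f (s + t)"
      by (simp add: mult_single lift_single)
    ultimately show ?case by (simp only: lift_single mult_ac)
  qed (simp add: lift_add distrib_left)
qed (simp add: lift_add distrib_right)

lemma lift_1: "monoid_map f \<Longrightarrow> lift f 1 = 1"
  by (simp add: lift_def monoid_map_def)

lemma lift_uminus: "lift f (- p) = - lift f p"
proof -
  have "lift f (- p) + lift f p = lift f (- p + p)" by (rule lift_add[symmetric])
  then show ?thesis by (simp add: eq_neg_iff_add_eq_0)
qed

lemma lift_diff: "lift f (p - q) = lift f p - lift f q"
  using lift_add[of f p "- q"] by (simp add: lift_uminus)

lemma lift_sum: "lift f (sum g A) = (\<Sum>a\<in>A. lift f (g a))"
  by (induction A rule: infinite_finite_induct) (auto simp: lift_add)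

definition power_prod :: "(nat \<times> nat \<Rightarrow> 'k::field mpoly) \<Rightarrow> ((nat \<times> nat) \<Rightarrow>\<^sub>0 nat) \<Rightarrow> 'k mpoly" where
  "power_prod g t = (\<Prod>v\<in>Poly_Mapping.keys t. g v ^ Poly_Mapping.lookup t v)"

lemma power_prod_superset:
  assumes "finite A" "Poly_Mapping.keys t \<subseteq> A"
  shows "power_prod g t = (\<Prod>v\<in>A. g v ^ Poly_Mapping.lookup t v)"
  unfolding power_prod_def using assms by (intro prod.mono_neutral_left) (auto simp: in_keys_iff)

lemma monoid_map_power_prod: "monoid_map (power_prod g)"
  unfolding monoid_map_def
proof (intro conjI allI)
  fix s t :: "(nat \<times> nat) \<Rightarrow>\<^sub>0 nat"
  let ?A = "Poly_Mapping.keys s \<union> Poly_Mapping.keys t"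
  have "power_prod g (s + t) = (\<Prod>v\<in>?A. g v ^ Poly_Mapping.lookup (s + t) v)"
    using keys_add[of s t] by (intro power_prod_superset) auto
  also have "\<dots> = power_prod g s * power_prod g t"
    by (subst (1 2) power_prod_superset[of ?A]) (auto simp: lookup_add power_add prod.distrib)
  finally show "power_prod g (s + t) = power_prod g s * power_prod g t" .
qed (simp add: power_prod_def)

definition subst :: "(nat \<times> nat \<Rightarrow> 'k::field mpoly) \<Rightarrow> 'k mpoly \<Rightarrow> 'k mpoly" where
  "subst g = lift (power_prod g)"

lemma subst_simps [simp]:
  "subst g 0 = 0" "subst g 1 = 1"
  "subst g (p + q) = subst g p + subst g q"
  "subst g (p * q) = subst g p * subst g q"
  "subst g (- p) = - subst g p"
  "subst g (p - q) = subst g p - subst g q"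
  "subst g (sum h A) = (\<Sum>a\<in>A. subst g (h a))"
  "subst g (cst c) = cst c"
  by (simp_all add: subst_def lift_add lift_mult lift_1 lift_uminus lift_diff lift_sum
      monoid_map_power_prod lift_single power_prod_def)

lemma subst_X [simp]: "subst g (X v) = g v"
  by (simp add: X_def subst_def lift_single power_prod_def)

lemma subst_cong_Ideal:
  assumes "Ideal Y" "\<And>v. g v - h v \<in> Y"
  shows "subst g p - subst h p \<in> Y"
proof (induction p rule: mpoly_induct)
  case (add p q)
  then show ?case using rid.subspace_add[OF assms(1) add] by (simp add: algebra_simps)
next
  case (mult p q)
  have "subst g (p * q) - subst h (p * q)
      = (subst g p - subst h p) * subst g q + subst h p * (subst g q - subst h q)"
    by (simp add: algebra_simps)
  then show ?case
    using assms(1) mult by (simp only: rid.subspace_add rid.subspace_scale Ideal_mult_right)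
qed (use assms rid.subspace_0 in auto)

lemma subst_id: "subst X p = p"
  by (induction p rule: mpoly_induct) auto

lemma subst_subst: "subst g (subst h p) = subst (\<lambda>v. subst g (h v)) p"
  by (induction p rule: mpoly_induct) auto

lemma subst_in_gen:
  assumes "p \<in> gen B" "\<And>b. b \<in> B \<Longrightarrow> subst g b \<in> Z" "Ideal Z"
  shows "subst g p \<in> Z"
  using assms(1)
proof (induction rule: rid.span_induct_alt)
  case (step c x y)
  then show ?case using assms(2,3) rid.subspace_add[of Z "subst g c * subst g x" "subst g y"]
      rid.subspace_scale[of Z "subst g x" "subst g c"] by simp
qed (use assms rid.subspace_0 in auto)

text \<open>\<open>subst g\<close> picks a representative of each class modulo \<open>Y\<close>, so
  the quotient embeds in the polynomial ring.\<close>

lemma mem_kernel_iff: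
  assumes "Ideal Y" "\<And>v. g v - X v \<in> Y" "\<And>y. y \<in> Y \<Longrightarrow> subst g y = 0"
  shows "p \<in> Y \<longleftrightarrow> subst g p = 0"
proof -
  have "subst g p - p \<in> Y"
    using subst_cong_Ideal[of Y g X p] assms(1,2) by (simp add: subst_id)
  then show ?thesis
    using assms(3)[of p] Ideal_diff_iff[OF assms(1), of "subst g p" p] rid.subspace_0[OF assms(1)]
    by auto
qed

text \<open>The polynomials form a domain, so the kernel of a substitution is prime.\<close>

lemma nzd_kernel:
  fixes f :: "'k::field mpoly"
  assumes "\<And>p. p \<in> Y \<longleftrightarrow> subst g p = 0" "f \<notin> Y"
  shows "nzd f Y"
  using assms by (simp add: nzd_def)

section \<open>Homogeneous ideals\<close>

definition mdeg :: "((nat \<times> nat) \<Rightarrow>\<^sub>0 nat) \<Rightarrow> nat" where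
  "mdeg t = (\<Sum>v\<in>Poly_Mapping.keys t. Poly_Mapping.lookup t v)"

lemma mdeg_superset:
  assumes "finite A" "Poly_Mapping.keys t \<subseteq> A"
  shows "mdeg t = (\<Sum>v\<in>A. Poly_Mapping.lookup t v)"
  unfolding mdeg_def using assms by (intro sum.mono_neutral_left) (auto simp: in_keys_iff)

lemma mdeg_add [simp]: "mdeg (s + t) = mdeg s + mdeg t"
proof -
  let ?A = "Poly_Mapping.keys s \<union> Poly_Mapping.keys t"
  have "mdeg (s + t) = (\<Sum>v\<in>?A. Poly_Mapping.lookup (s + t) v)"
    using keys_add[of s t] by (intro mdeg_superset) auto
  also have "\<dots> = mdeg s + mdeg t"
    by (subst (1 2) mdeg_superset[of ?A]) (auto simp: lookup_add sum.distrib)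
  finally show ?thesis .
qed

lemma mdeg_single [simp]: "mdeg (Poly_Mapping.single v k) = k"
  by (simp add: mdeg_def)

definition homog :: "nat \<Rightarrow> 'k::field mpoly \<Rightarrow> bool" where
  "homog d p \<longleftrightarrow> (\<forall>t\<in>Poly_Mapping.keys p. mdeg t = d)"

definition order_ge :: "nat \<Rightarrow> 'k::field mpoly \<Rightarrow> bool" where
  "order_ge d p \<longleftrightarrow> (\<forall>t\<in>Poly_Mapping.keys p. d \<le> mdeg t)"

lemma homog_order_ge: "homog d p \<Longrightarrow> order_ge d p"
  by (auto simp: homog_def order_ge_def)

lemma homog_X [simp]: "homog (Suc 0) (X v)"
  by (simp add: X_def homog_def)

lemma homog_add: "homog d p \<Longrightarrow> homog d q \<Longrightarrow> homog d (p + q)"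
  using keys_add[of p q] by (auto simp: homog_def)

lemma homog_uminus: "homog d p \<Longrightarrow> homog d (- p)"
  by (auto simp: homog_def in_keys_iff)

lemma homog_diff: "homog d p \<Longrightarrow> homog d q \<Longrightarrow> homog d (p - q)"
  using homog_add[of d p "- q"] homog_uminus[of d q] by simp

lemma homog_mult: "homog d p \<Longrightarrow> homog e q \<Longrightarrow> homog (d + e) (p * q)"
  using keys_mult[of p q] by (fastforce simp: homog_def)

lemma homog_sum: "(\<And>a. a \<in> A \<Longrightarrow> homog d (f a)) \<Longrightarrow> homog d (sum f A)"
  by (induction A rule: infinite_finite_induct) (auto intro: homog_add simp: homog_def[of _ 0])

lemma order_ge_mult: "order_ge d p \<Longrightarrow> order_ge e q \<Longrightarrow> order_ge (d + e) (p * q)"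
  using keys_mult[of p q] by (fastforce simp: order_ge_def intro: add_mono)

lemma order_ge_power: "order_ge (Suc 0) p \<Longrightarrow> order_ge k (p ^ k * q)"
proof (induction k)
  case (Suc k)
  then have "order_ge (1 + k) (p * (p ^ k * q))" by (intro order_ge_mult) simp_all
  then show ?case by (simp only: power_Suc mult.assoc plus_1_eq_Suc)
qed (simp add: order_ge_def)

definition hcomp :: "nat \<Rightarrow> 'k::field mpoly \<Rightarrow> 'k mpoly" where
  "hcomp d = lift (\<lambda>t. if mdeg t = d then Poly_Mapping.single t 1 else 0)"

lemma hcomp_single:
  "hcomp d (Poly_Mapping.single t c) = (if mdeg t = d then Poly_Mapping.single t c else 0)"
  by (simp add: hcomp_def lift_single mult_single)

lemma hcomp_add: "hcomp d (p + q) = hcomp d p + hcomp d q"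
  by (simp add: hcomp_def lift_add)

lemma hcomp_diff: "hcomp d (p - q) = hcomp d p - hcomp d q"
  by (simp add: hcomp_def lift_diff)

lemma hcomp_0 [simp]: "hcomp d 0 = 0"
  by (simp add: hcomp_def)

lemma lookup_hcomp:
  "Poly_Mapping.lookup (hcomp d p) t = (if mdeg t = d then Poly_Mapping.lookup p t else 0)"
  by (induction p rule: poly_mapping_term_induct)
    (auto simp: hcomp_single hcomp_add lookup_add lookup_single when_def)

lemma hcomp_homog: "homog e p \<Longrightarrow> hcomp d p = (if d = e then p else 0)"
  by (rule poly_mapping_eqI) (auto simp: lookup_hcomp homog_def in_keys_iff)

lemma hcomp_order_ge: "order_ge e p \<Longrightarrow> d < e \<Longrightarrow> hcomp d p = 0"
  by (rule poly_mapping_eqI) (force simp: lookup_hcomp order_ge_def in_keys_iff)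

lemma sum_hcomp: "(\<Sum>d\<in>mdeg ` Poly_Mapping.keys p. hcomp d p) = p"
proof (rule poly_mapping_eqI)
  fix t
  show "Poly_Mapping.lookup (\<Sum>d\<in>mdeg ` Poly_Mapping.keys p. hcomp d p) t = Poly_Mapping.lookup p t"
    by (simp add: lookup_sum lookup_hcomp sum.delta' in_keys_iff image_iff) (metis in_keys_iff)
qed

definition hIdeal :: "'k::field mpoly set \<Rightarrow> bool" where
  "hIdeal Y \<longleftrightarrow> (\<exists>B. (\<forall>b\<in>B. \<exists>d. homog d b) \<and> Y = gen B)"

lemma hIdeal_Ideal: "hIdeal Y \<Longrightarrow> Ideal Y"
  by (auto simp: hIdeal_def)

lemma hIdeal_adjoin: "hIdeal Y \<Longrightarrow> homog d f \<Longrightarrow> hIdeal (adjoin Y f)"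
proof -
  assume "hIdeal Y" and f: "homog d f"
  then obtain B where B: "\<forall>b\<in>B. \<exists>d. homog d b" "Y = gen B" by (auto simp: hIdeal_def)
  have "adjoin Y f = gen (insert f B)" by (simp add: B(2) adjoin_gen)
  then show ?thesis unfolding hIdeal_def using B(1) f by (intro exI[of _ "insert f B"]) auto
qed

lemma hcomp_in_hIdeal:
  assumes "hIdeal Y" "u \<in> Y"
  shows "hcomp d u \<in> Y"
proof -
  obtain B where B: "\<forall>b\<in>B. \<exists>d. homog d b" "Y = gen B"
    using assms(1) by (auto simp: hIdeal_def)
  have *: "hcomp d (c * b) \<in> gen B" if "b \<in> B" for b c
  proof -
    obtain e where e: "homog e b" using B(1) \<open>b \<in> B\<close> by blast
    show ?thesis
    proof (induction c rule: poly_mapping_term_induct)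
      case (single t a)
      have "homog (mdeg t + e) (Poly_Mapping.single t a * b)"
        by (rule homog_mult[OF _ e]) (simp add: homog_def)
      then show ?case
        using \<open>b \<in> B\<close> by (simp add: hcomp_homog rid.span_scale rid.span_base rid.span_zero)
    qed (simp add: distrib_right hcomp_add rid.span_add)
  qed
  have "u \<in> gen B" using assms(2) B(2) by simp
  then have "hcomp d u \<in> gen B"
    by (induction rule: rid.span_induct_alt) (simp_all add: rid.span_zero hcomp_add rid.span_add *)
  then show ?thesis using B(2) by simp
qed

text \<open>Graded substitute for Krull's intersection theorem: \<open>f ^ Suc d * v\<close> has no
  component in degree \<open>d\<close>, so \<open>hcomp d u\<close> already lies in
  \<open>Y\<close>.\<close>

lemma hIdeal_separated:
  assumes "hIdeal Y" "order_ge (Suc 0) f" "\<And>k. \<exists>v. u - f ^ k * v \<in> Y"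
  shows "u \<in> Y"
proof -
  have "hcomp d u \<in> Y" for d
  proof -
    obtain v where v: "u - f ^ Suc d * v \<in> Y" using assms(3) by blast
    have "hcomp d (f ^ Suc d * v) = 0"
      using order_ge_power[OF assms(2), of "Suc d" v] by (rule hcomp_order_ge) simp
    then show ?thesis using hcomp_in_hIdeal[OF assms(1) v, of d] by (simp add: hcomp_diff)
  qed
  then have "(\<Sum>d\<in>mdeg ` Poly_Mapping.keys u. hcomp d u) \<in> Y"
    by (intro rid.subspace_sum[OF hIdeal_Ideal[OF assms(1)]])
  then show ?thesis by (simp add: sum_hcomp)
qed

lemma reg_swap:
  assumes "hIdeal Y" "order_ge (Suc 0) f" "reg Y (f # g # fs)"
  shows "reg Y (g # f # fs)"
  using assms nzd_swap[where Y = Y and f = f and g = g, OF hIdeal_Ideal hIdeal_separated]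
  by (simp add: adjoin_commute)

lemma reg_move_to_front:
  assumes "hIdeal Y" "\<forall>f\<in>set (fs @ g # gs). homog (Suc 0) f"
  shows "reg Y (fs @ g # gs) \<longleftrightarrow> reg Y (g # fs @ gs)"
  using assms
proof (induction fs arbitrary: Y)
  case (Cons f fs)
  have "order_ge (Suc 0) f" "order_ge (Suc 0) g" using Cons.prems(2) by (auto intro: homog_order_ge)
  then have "reg Y (f # g # fs @ gs) \<longleftrightarrow> reg Y (g # f # fs @ gs)"
    using reg_swap[of Y f g "fs @ gs"] reg_swap[of Y g f "fs @ gs"] Cons.prems(1) by blast
  moreover have "hIdeal (adjoin Y f)" using Cons.prems by (auto intro: hIdeal_adjoin)
  then have "reg (adjoin Y f) (fs @ g # gs) \<longleftrightarrow> reg (adjoin Y f) (g # fs @ gs)"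
    using Cons.prems by (intro Cons.IH) auto
  ultimately show ?case by simp
qed simp

text \<open>All prefix ideals are homogeneous, so neighbours can be exchanged by
  \<open>nzd_swap\<close>. Reordering is needed to move a corner variable behind the diagonals, and
  to bring the cyclic sums to the front.\<close>

lemma reg_perm:
  assumes "hIdeal Y" "\<forall>f\<in>set fs. homog (Suc 0) f" "mset fs = mset gs" "reg Y fs"
  shows "reg Y gs"
  using assms
proof (induction fs arbitrary: Y gs)
  case (Cons f fs)
  have "f \<in> set gs" using Cons.prems(3) by (metis list.set_intros(1) set_mset_mset)
  then obtain as bs where gs: "gs = as @ f # bs" by (meson split_list)
  have "hIdeal (adjoin Y f)" using Cons.prems by (auto intro: hIdeal_adjoin)
  then have "reg (adjoin Y f) (as @ bs)"
    using Cons.prems gs by (intro Cons.IH[of "adjoin Y f" "as @ bs"]) auto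
  then have "reg Y (f # as @ bs)" using Cons.prems by simp
  moreover have "\<forall>h\<in>set (as @ f # bs). homog (Suc 0) h"
    using Cons.prems(2,3) gs by (metis set_mset_mset)
  ultimately show ?case using reg_move_to_front[OF Cons.prems(1)] gs by blast
qed simp

section \<open>Ideals generated by variables and minors\<close>

definition minor2 :: "nat \<Rightarrow> nat \<Rightarrow> nat \<Rightarrow> nat \<Rightarrow> 'k::field mpoly" where
  "minor2 i j k l = X (i, k) * X (j, l) - X (i, l) * X (j, k)"

text \<open>\<open>Z\<close> is the set of variables put to zero. All ideals used below contain the variables
  outside \<open>[m] \<times> [n]\<close>, so that quotients of \<open>poly_ring m n\<close> are quotients of the whole polynomial type.\<close>

definition minor_ideal :: "(nat \<times> nat) set \<Rightarrow> (nat \<times> nat) set \<Rightarrow> 'k::field mpoly set" where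
  "minor_ideal E Z = gen (X ` Z \<union> {minor2 i j k l | i j k l. (k, l) \<in> E})"

lemma X_in_minor_ideal: "v \<in> Z \<Longrightarrow> X v \<in> minor_ideal E Z"
  by (auto simp: minor_ideal_def intro: rid.span_base)

lemma minor2_in_minor_ideal: "(k, l) \<in> E \<Longrightarrow> minor2 i j k l \<in> minor_ideal E Z"
  unfolding minor_ideal_def by (intro rid.span_base) blast

lemma Ideal_minor_ideal [simp]: "Ideal (minor_ideal E Z)"
  by (simp add: minor_ideal_def)

lemma minor_ideal_least:
  assumes "\<And>v. v \<in> Z \<Longrightarrow> X v \<in> Y" "\<And>i j k l. (k, l) \<in> E \<Longrightarrow> minor2 i j k l \<in> Y" "Ideal Y"
  shows "minor_ideal E Z \<subseteq> Y"
  unfolding minor_ideal_def using assms by (intro rid.span_minimal) auto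

lemma minor_ideal_mono: "E \<subseteq> E' \<Longrightarrow> Z \<subseteq> Z' \<Longrightarrow> minor_ideal E Z \<subseteq> minor_ideal E' Z'"
  by (intro minor_ideal_least) (auto intro: X_in_minor_ideal minor2_in_minor_ideal)

lemma homog_minor2: "homog 2 (minor2 i j k l)"
  unfolding minor2_def
  using homog_mult[OF homog_X homog_X] by (intro homog_diff) (simp_all add: numeral_2_eq_2)

lemma hIdeal_minor_ideal: "hIdeal (minor_ideal E Z)"
  unfolding hIdeal_def minor_ideal_def by (rule exI, rule conjI[OF _ refl]) (use homog_X homog_minor2 in blast)

lemma adjoin_minor_ideal: "adjoin (minor_ideal E Z) (X v) = minor_ideal E (insert v Z)"
  unfolding minor_ideal_def adjoin_gen by simp

lemma ideal_sum_minor_ideal: "ideal_sum (minor_ideal E Z) (minor_ideal E' Z') = minor_ideal (E \<union> E') (Z \<union> Z')"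
proof
  show "ideal_sum (minor_ideal E Z) (minor_ideal E' Z') \<subseteq> minor_ideal (E \<union> E') (Z \<union> Z')"
    unfolding ideal_sum_def using minor_ideal_mono[of E "E \<union> E'" Z "Z \<union> Z'"] minor_ideal_mono[of E' "E \<union> E'" Z' "Z \<union> Z'"]
    by (intro rid.span_minimal) auto
  have "minor_ideal E Z \<union> minor_ideal E' Z' \<subseteq> ideal_sum (minor_ideal E Z) (minor_ideal E' Z')"
    unfolding ideal_sum_def by (rule rid.span_superset)
  then show "minor_ideal (E \<union> E') (Z \<union> Z') \<subseteq> ideal_sum (minor_ideal E Z) (minor_ideal E' Z')"
    by (intro minor_ideal_least) (auto intro: X_in_minor_ideal minor2_in_minor_ideal)
qed

definition kill :: "(nat \<times> nat) set \<Rightarrow> 'k::field mpoly \<Rightarrow> 'k mpoly" where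
  "kill Z = subst (\<lambda>v. if v \<in> Z then 0 else X v)"

lemma kill_X: "kill Z (X v) = (if v \<in> Z then 0 else X v)"
  by (simp add: kill_def)

lemma kill_mult: "kill Z (p * q) = kill Z p * kill Z q"
  by (simp add: kill_def)

lemma kill_add: "kill Z (p + q) = kill Z p + kill Z q"
  by (simp add: kill_def)

lemma kill_diff: "kill Z (p - q) = kill Z p - kill Z q"
  by (simp add: kill_def)

lemma kill_kill [simp]: "kill Z (kill Z p) = kill Z p"
  unfolding kill_def subst_subst
  by (rule arg_cong[where f = "\<lambda>g. subst g p"]) (auto simp: kill_X[unfolded kill_def])

lemma kill_minor2:
  "kill (- (R \<times> C)) (minor2 i j k l)
     = (if i \<in> R \<and> j \<in> R \<and> k \<in> C \<and> l \<in> C then minor2 i j k l else 0)"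
  by (simp add: minor2_def kill_diff kill_mult kill_X)

text \<open>The substitution sends a generator to \<open>0\<close> or to a minor inside
  \<open>R \<times> C\<close>; no variable survives as a generator, hence the freedom in
  \<open>Z\<close>.\<close>

lemma kill_minor_ideal:
  assumes "u \<in> minor_ideal E (- (R \<times> C))"
  shows "kill (- (R \<times> C)) u \<in> minor_ideal (E \<inter> C \<times> C) Z"
  using assms unfolding minor_ideal_def[of E] kill_def
proof (rule subst_in_gen)
  fix b assume "b \<in> X ` (- (R \<times> C)) \<union> {minor2 i j k l | i j k l. (k, l) \<in> E}"
  then have "kill (- (R \<times> C)) b \<in> minor_ideal (E \<inter> C \<times> C) Z"
    by (auto simp: kill_X kill_minor2 rid.subspace_0 intro: minor2_in_minor_ideal split: if_splits)
  then show "subst (\<lambda>v. if v \<in> - (R \<times> C) then 0 else X v) b \<in> minor_ideal (E \<inter> C \<times> C) Z"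
    by (simp only: kill_def)
qed simp

lemma kill_diff_in:
  assumes "Ideal Y" "\<And>v. v \<in> Z \<Longrightarrow> X v \<in> Y"
  shows "p - kill Z p \<in> Y"
proof -
  have "subst (\<lambda>v. if v \<in> Z then 0 else X v) p - subst X p \<in> Y"
    by (rule subst_cong_Ideal) (auto simp: assms rid.subspace_neg rid.subspace_0)
  then have "kill Z p - p \<in> Y" by (simp add: kill_def subst_id)
  then show ?thesis using rid.subspace_neg[OF assms(1)] by fastforce
qed

text \<open>Lets a claim \<open>f * p \<in> Y\<close> for all \<open>p\<close> in an ideal be
  checked on generators, in particular on the variables that \<open>kill\<close> removes.\<close>

lemma Ideal_colon: "Ideal Y \<Longrightarrow> Ideal {p. f * p \<in> Y}"
proof (rule rid.subspaceI; simp)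
  assume Y: "Ideal Y"
  show "0 \<in> Y" by (rule rid.subspace_0[OF Y])
  show "f * (x + y) \<in> Y" if "f * x \<in> Y" "f * y \<in> Y" for x y
    using rid.subspace_add[OF Y that] by (simp add: distrib_left)
  show "f * (c * x) \<in> Y" if "f * x \<in> Y" for c x
    using rid.subspace_scale[OF Y that, of c] by (simp add: mult.left_commute)
qed

section \<open>Rank one matrices\<close>

text \<open>The exponents of the variables \<open>(0, i)\<close> and \<open>(1, j)\<close> record the contents of row \<open>i\<close> and of
  column \<open>j\<close>; the induced map is the parametrization of rank one matrices.\<close>

definition content :: "((nat \<times> nat) \<Rightarrow>\<^sub>0 nat) \<Rightarrow> ((nat \<times> nat) \<Rightarrow>\<^sub>0 nat)" where
  "content t = (\<Sum>v\<in>Poly_Mapping.keys t. Poly_Mapping.single (0, fst v) (Poly_Mapping.lookup t v)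
      + Poly_Mapping.single (1, snd v) (Poly_Mapping.lookup t v))"

lemma content_superset:
  assumes "finite A" "Poly_Mapping.keys t \<subseteq> A"
  shows "content t = (\<Sum>v\<in>A. Poly_Mapping.single (0, fst v) (Poly_Mapping.lookup t v)
      + Poly_Mapping.single (1, snd v) (Poly_Mapping.lookup t v))"
  unfolding content_def using assms by (intro sum.mono_neutral_left) (auto simp: in_keys_iff)

lemma content_add: "content (s + t) = content s + content t"
proof -
  let ?A = "Poly_Mapping.keys s \<union> Poly_Mapping.keys t"
  have "content (s + t) = (\<Sum>v\<in>?A. Poly_Mapping.single (0, fst v) (Poly_Mapping.lookup (s + t) v)
      + Poly_Mapping.single (1, snd v) (Poly_Mapping.lookup (s + t) v))"
    using keys_add[of s t] by (intro content_superset) auto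
  also have "\<dots> = content s + content t"
    by (subst (1 2) content_superset[of ?A])
      (auto simp: lookup_add single_add sum.distrib[symmetric] algebra_simps)
  finally show ?thesis .
qed

lemma content_single:
  "content (Poly_Mapping.single (i, j) k) = Poly_Mapping.single (0, i) k + Poly_Mapping.single (1, j) k"
  by (simp add: content_def)

lemma lookup_content_row:
  "Poly_Mapping.lookup (content t) (0, i) = (\<Sum>v\<in>Poly_Mapping.keys t. if fst v = i then Poly_Mapping.lookup t v else 0)"
  by (simp add: content_def lookup_sum lookup_add lookup_single when_def)

lemma lookup_content_col:
  "Poly_Mapping.lookup (content t) (1, j) = (\<Sum>v\<in>Poly_Mapping.keys t. if snd v = j then Poly_Mapping.lookup t v else 0)"
  by (simp add: content_def lookup_sum lookup_add lookup_single when_def)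

lemma content_row_pos: "Poly_Mapping.lookup (content t) (0, i) > 0 \<longleftrightarrow> (\<exists>l. (i, l) \<in> Poly_Mapping.keys t)"
  unfolding lookup_content_row neq0_conv[symmetric] by (force simp: in_keys_iff)

lemma content_col_pos: "Poly_Mapping.lookup (content t) (1, j) > 0 \<longleftrightarrow> (\<exists>k. (k, j) \<in> Poly_Mapping.keys t)"
  unfolding lookup_content_col neq0_conv[symmetric] by (force simp: in_keys_iff)

lemma monomial_split:
  fixes t :: "'a \<Rightarrow>\<^sub>0 nat"
  assumes "v \<in> Poly_Mapping.keys t"
  obtains t' where "t = t' + Poly_Mapping.single v 1"
proof
  show "t = Poly_Mapping.update v (Poly_Mapping.lookup t v - 1) t + Poly_Mapping.single v 1"
    using assms by (intro poly_mapping_eqI) (auto simp: lookup_add lookup_update lookup_single in_keys_iff when_def)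
qed

lemma single_times_X:
  "Poly_Mapping.single (t + Poly_Mapping.single v 1) c = Poly_Mapping.single t c * X v"
  by (simp add: X_def mult_single)

text \<open>The induction removes a variable \<open>x\<^sub>i\<^sub>j\<close> of \<open>s\<close>, which also occurs in \<open>t\<close> after at
  most one exchange of \<open>x\<^sub>i\<^sub>l x\<^sub>k\<^sub>j\<close> for \<open>x\<^sub>i\<^sub>j x\<^sub>k\<^sub>l\<close>.\<close>

lemma content_eq_imp_cong:
  assumes "content s = content t"
  shows "Poly_Mapping.single s 1 - Poly_Mapping.single t 1 \<in> minor_ideal UNIV Z"
  using assms
proof (induction "mdeg s" arbitrary: s t)
  case 0
  have s: "s = 0"
  proof (rule poly_mapping_eqI)
    show "Poly_Mapping.lookup s v = Poly_Mapping.lookup 0 v" for v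
      using 0(1) by (cases v) (auto simp: mdeg_def in_keys_iff)
  qed
  have "content t = 0" using 0(2) by (simp add: s content_def)
  then have "v \<notin> Poly_Mapping.keys t" for v
    using content_row_pos[of t "fst v"] by (cases v) auto
  then have "t = 0" by (intro poly_mapping_eqI) (simp add: in_keys_iff)
  with s show ?case by (simp add: rid.subspace_0)
next
  case (Suc d)
  have "Poly_Mapping.keys s \<noteq> {}" using Suc(2) by (auto simp: mdeg_def)
  then obtain i j where ij: "(i, j) \<in> Poly_Mapping.keys s" by (metis all_not_in_conv surj_pair)
  then obtain s' where s': "s = s' + Poly_Mapping.single (i, j) 1" by (rule monomial_split)
  have d: "d = mdeg s'" using Suc(2) by (simp add: s')
  have key: ?case if t': "content t = content (t' + Poly_Mapping.single (i, j) 1)"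
    "Poly_Mapping.single (t' + Poly_Mapping.single (i, j) 1) 1 - Poly_Mapping.single t 1 \<in> (minor_ideal UNIV Z :: 'a mpoly set)" for t'
  proof -
    have "content s' = content t'" using t'(1) Suc(3) by (simp add: s' content_add)
    from Suc(1)[OF d this] have "(Poly_Mapping.single s' 1 - Poly_Mapping.single t' 1) * X (i, j) \<in> (minor_ideal UNIV Z :: 'a mpoly set)"
      by (intro Ideal_mult_right) simp_all
    then have "Poly_Mapping.single s 1 - Poly_Mapping.single (t' + Poly_Mapping.single (i, j) 1) 1 \<in> (minor_ideal UNIV Z :: 'a mpoly set)"
      unfolding s' single_times_X by (simp add: left_diff_distrib)
    from rid.subspace_add[OF Ideal_minor_ideal this t'(2)] show ?thesis by simp
  qed
  obtain l where l: "(i, l) \<in> Poly_Mapping.keys t"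
    using content_row_pos[of s i] content_row_pos[of t i] ij Suc(3) by auto
  obtain k where k: "(k, j) \<in> Poly_Mapping.keys t"
    using content_col_pos[of s j] content_col_pos[of t j] ij Suc(3) by auto
  show ?case
  proof (cases "(i, l) = (k, j)")
    case True
    then obtain t' where t': "t = t' + Poly_Mapping.single (i, j) 1" using l by (auto elim: monomial_split)
    show ?thesis by (rule key[of t']) (simp_all add: t' rid.subspace_0)
  next
    case False
    obtain t1 where t1: "t = t1 + Poly_Mapping.single (i, l) 1" using l by (rule monomial_split)
    have "(k, j) \<in> Poly_Mapping.keys t1"
      using k False by (auto simp: t1 in_keys_iff lookup_add lookup_single when_def split: if_splits)
    then obtain t2 where t2: "t1 = t2 + Poly_Mapping.single (k, j) 1" by (rule monomial_split)
    let ?t' = "t2 + Poly_Mapping.single (k, l) 1"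
    have "content t = content (?t' + Poly_Mapping.single (i, j) 1)"
      by (simp add: t1 t2 content_add content_single add_ac)
    moreover have "Poly_Mapping.single (?t' + Poly_Mapping.single (i, j) 1) 1 - Poly_Mapping.single t 1
        = Poly_Mapping.single t2 1 * (minor2 i k j l :: 'a mpoly)"
      unfolding t1 t2 single_times_X minor2_def by (simp add: algebra_simps)
    then have "Poly_Mapping.single (?t' + Poly_Mapping.single (i, j) 1) 1 - Poly_Mapping.single t 1 \<in> (minor_ideal UNIV Z :: 'a mpoly set)"
      by (simp add: rid.subspace_scale minor2_in_minor_ideal)
    ultimately show ?thesis by (rule key)
  qed
qed

definition content_image :: "nat set \<Rightarrow> nat set \<Rightarrow> ((nat \<times> nat) \<Rightarrow>\<^sub>0 nat) \<Rightarrow> 'k::field mpoly" where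
  "content_image R C t = (if Poly_Mapping.keys t \<subseteq> R \<times> C then Poly_Mapping.single (content t) 1 else 0)"

lemma monoid_map_content_image: "monoid_map (content_image R C)"
proof -
  have "Poly_Mapping.keys (s + t) = Poly_Mapping.keys s \<union> Poly_Mapping.keys t" for s t :: "(nat \<times> nat) \<Rightarrow>\<^sub>0 nat"
    by (auto simp: in_keys_iff lookup_add)
  moreover have "content 0 = 0" by (simp add: content_def)
  ultimately show ?thesis by (auto simp: monoid_map_def content_image_def content_add mult_single)
qed

lemma lift_content_image_X:
  "lift (content_image R C) (X (i, j)) = (if i \<in> R \<and> j \<in> C
     then Poly_Mapping.single (Poly_Mapping.single (0, i) 1 + Poly_Mapping.single (1, j) 1) 1 else 0)"
  by (simp add: X_def lift_single content_image_def content_single)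

lemma lift_content_image_minor_ideal:
  assumes "u \<in> minor_ideal UNIV (- (R \<times> C))"
  shows "lift (content_image R C) u = 0"
  using assms unfolding minor_ideal_def
proof (induction rule: rid.span_induct_alt)
  case (step c x y)
  have "lift (content_image R C) x = 0"
    using step(1)
    by (auto simp: lift_content_image_X minor2_def lift_diff lift_mult monoid_map_content_image mult_single add_ac
        split: if_splits)
  with step show ?case by (simp add: lift_add lift_mult monoid_map_content_image)
qed simp

lemma single_in_minor_ideal:
  assumes "v \<in> Poly_Mapping.keys t" "v \<in> Z"
  shows "Poly_Mapping.single t c \<in> minor_ideal E Z"
proof -
  obtain t' where "t = t' + Poly_Mapping.single v 1" using assms(1) by (rule monomial_split)
  then show ?thesis
    using assms(2) by (simp only: single_times_X) (simp add: rid.subspace_scale X_in_minor_ideal)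
qed

lemma keys_minus_single:
  "Poly_Mapping.keys (u - Poly_Mapping.single t (Poly_Mapping.lookup u t)) = Poly_Mapping.keys u - {t}"
  by (auto simp: in_keys_iff lookup_minus lookup_single when_def split: if_splits)

text \<open>Monomials of equal content are congruent, so terms can be merged: a term of a kernel
  element either contains a variable put to zero or shares its content with another term, and in
  both cases it can be removed modulo the ideal. The induction is on the number of terms.\<close>

lemma lift_content_image_kernel:
  fixes u :: "'k::field mpoly"
  assumes "lift (content_image R C) u = 0"
  shows "u \<in> minor_ideal UNIV (- (R \<times> C))"
  using assms
proof (induction "card (Poly_Mapping.keys u)" arbitrary: u rule: less_induct)
  case less
  let ?Y = "minor_ideal UNIV (- (R \<times> C)) :: 'k mpoly set"
  show ?case
  proof (cases "u = 0")
    case False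
    then obtain t where t: "t \<in> Poly_Mapping.keys u"
      by (metis poly_mapping_eqI in_keys_iff lookup_zero)
    define c where "c = Poly_Mapping.lookup u t"
    have fewer: "w \<in> ?Y" if "Poly_Mapping.keys w \<subseteq> Poly_Mapping.keys u - {t}" "lift (content_image R C) w = 0" for w
    proof (rule less(1)[OF _ that(2)])
      have "card (Poly_Mapping.keys w) \<le> card (Poly_Mapping.keys u - {t})"
        using that(1) by (intro card_mono) auto
      also have "\<dots> < card (Poly_Mapping.keys u)" using t by (intro card_Diff1_less) auto
      finally show "card (Poly_Mapping.keys w) < card (Poly_Mapping.keys u)" .
    qed
    show ?thesis
    proof (cases "Poly_Mapping.keys t \<subseteq> R \<times> C")
      case False
      then obtain v where "v \<in> Poly_Mapping.keys t" "v \<in> - (R \<times> C)" by blast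
      then have tY: "Poly_Mapping.single t c \<in> ?Y" by (rule single_in_minor_ideal)
      have "u - Poly_Mapping.single t c \<in> ?Y"
        using less(2) False by (intro fewer) (simp_all add: c_def keys_minus_single lift_diff lift_single content_image_def)
      from rid.subspace_add[OF Ideal_minor_ideal this tY] show ?thesis by simp
    next
      case True
      have "\<exists>s\<in>Poly_Mapping.keys u - {t}. Poly_Mapping.keys s \<subseteq> R \<times> C \<and> content s = content t"
      proof (rule ccontr)
        assume neg: "\<not> ?thesis"
        have "0 = Poly_Mapping.lookup (lift (content_image R C) u) (content t)" using less(2) by simp
        also have "\<dots> = (\<Sum>s\<in>Poly_Mapping.keys u.
            if Poly_Mapping.keys s \<subseteq> R \<times> C \<and> content s = content t then Poly_Mapping.lookup u s else 0)"
          unfolding lift_def lookup_sum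
          by (rule sum.cong) (auto simp: content_image_def mult_single lookup_single when_def)
        also have "\<dots> = (\<Sum>s\<in>Poly_Mapping.keys u. if s = t then Poly_Mapping.lookup u s else 0)"
          using neg True by (intro sum.cong) auto
        also have "\<dots> = c" using t by (simp add: c_def)
        finally show False using t by (simp add: c_def in_keys_iff)
      qed
      then obtain s where s: "s \<in> Poly_Mapping.keys u" "s \<noteq> t" "Poly_Mapping.keys s \<subseteq> R \<times> C" "content s = content t"
        by blast
      \<comment> \<open>The coefficient of \<open>t\<close> is moved to \<open>s\<close>, which
        changes neither the class nor the image and loses a term.\<close>
      let ?w = "u - Poly_Mapping.single t c + Poly_Mapping.single s c"
      have "?w \<in> ?Y"
      proof (rule fewer)
        show "Poly_Mapping.keys ?w \<subseteq> Poly_Mapping.keys u - {t}"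
          using keys_add[of "u - Poly_Mapping.single t c" "Poly_Mapping.single s c"] s(1,2)
          by (auto simp: c_def keys_minus_single split: if_splits)
        show "lift (content_image R C) ?w = 0"
          using less(2) s True by (simp add: lift_add lift_diff lift_single content_image_def)
      qed
      moreover have "cst c * (Poly_Mapping.single s 1 - Poly_Mapping.single t 1) \<in> ?Y"
        by (intro rid.subspace_scale content_eq_imp_cong s) simp
      then have "Poly_Mapping.single s c - Poly_Mapping.single t c \<in> ?Y"
        by (simp add: right_diff_distrib mult_single)
      ultimately have "?w - (Poly_Mapping.single s c - Poly_Mapping.single t c) \<in> ?Y"
        by (rule rid.subspace_diff[OF Ideal_minor_ideal])
      then show ?thesis by simp
    qed
  qed (simp add: rid.subspace_0)
qed

text \<open>The ideal is the whole kernel of a map to a domain, and a variable inside the block goes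
  to a nonzero monomial.\<close>

lemma nzd_X_Segre:
  assumes "i \<in> R" "j \<in> C"
  shows "nzd (X (i, j) :: 'k::field mpoly) (minor_ideal UNIV (- (R \<times> C)))"
  unfolding nzd_def
proof (intro allI impI)
  fix u :: "'k mpoly" assume "X (i, j) * u \<in> minor_ideal UNIV (- (R \<times> C))"
  then have "lift (content_image R C) (X (i, j)) * lift (content_image R C) u = 0"
    using lift_content_image_minor_ideal by (metis lift_mult monoid_map_content_image)
  moreover have "lift (content_image R C) (X (i, j)) \<noteq> (0 :: 'k mpoly)"
    using assms by (simp add: lift_content_image_X) (metis lookup_single_eq lookup_zero one_neq_zero)
  ultimately show "u \<in> minor_ideal UNIV (- (R \<times> C))" by (simp add: lift_content_image_kernel)
qed

text \<open>Modulo \<open>W\<close>, an element of \<open>gen B\<close> is represented by a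
  polynomial that \<open>kill Z\<close> fixes. If the element lies in \<open>Y\<close>, so does the
  representative, which then equals its own image and belongs to \<open>W\<close>. This replaces
  primary decompositions and Groebner bases.\<close>

lemma kill_Int_subset:
  fixes W :: "'k::field mpoly set"
  assumes W: "Ideal W" and Y: "Ideal Y" "W \<subseteq> Y" "\<And>y. y \<in> Y \<Longrightarrow> kill Z y \<in> W"
    and B: "\<And>x c. x \<in> B \<Longrightarrow> \<exists>w. c * x - kill Z w \<in> W"
  shows "gen B \<inter> Y \<subseteq> W"
proof
  fix u assume u: "u \<in> gen B \<inter> Y"
  then have "u \<in> gen B" by simp
  then have "\<exists>w. u - kill Z w \<in> W"
  proof (induction rule: rid.span_induct_alt)
    case base
    show ?case by (rule exI[of _ 0]) (simp add: kill_def rid.subspace_0[OF W])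
  next
    case (step c x y)
    obtain w where w: "c * x - kill Z w \<in> W" using B[OF step(1)] by blast
    obtain w' where w': "y - kill Z w' \<in> W" using step(2) by blast
    have "c * x + y - kill Z (w + w') = (c * x - kill Z w) + (y - kill Z w')" by (simp add: kill_add)
    then have "c * x + y - kill Z (w + w') \<in> W"
      using rid.subspace_add[OF W w w'] by (simp only:)
    then show ?case by blast
  qed
  then obtain w where w: "u - kill Z w \<in> W" by blast
  then have "kill Z w \<in> Y" using u Y Ideal_diff_iff[OF Y(1), of u "kill Z w"] by blast
  then have "kill Z w \<in> W" using Y(3)[of "kill Z w"] by simp
  then show "u \<in> W" using w Ideal_diff_iff[OF W] by blast
qed

text \<open>Ideal-theoretic form of a fact on rank one matrices: if the entry \<open>(a, b)\<close>
  is zero, then row \<open>a\<close> or column \<open>b\<close> vanishes.\<close>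

lemma minor_ideal_row_Int_col:
  assumes "a \<in> R" "b \<in> C"
  shows "minor_ideal UNIV (- ((R - {a}) \<times> C)) \<inter> minor_ideal UNIV (- (R \<times> (C - {b})))
    = (minor_ideal UNIV (insert (a, b) (- (R \<times> C))) :: 'k::field mpoly set)" (is "?Y1 \<inter> ?Y2 = ?W")
proof
  show "?W \<subseteq> ?Y1 \<inter> ?Y2" by (intro Int_greatest minor_ideal_mono) auto
  let ?s = "kill (- (R \<times> (C - {b}))) :: 'k mpoly \<Rightarrow> 'k mpoly"
  \<comment> \<open>\<open>c - ?s c\<close> is a combination of the killed variables. Of these, the
    \<open>X (i, b)\<close> with \<open>(i, b)\<close> in \<open>R \<times> C\<close> are dealt with
    by exchanging \<open>X (a, j) * X (i, b)\<close> for \<open>X (i, j) * X (a, b)\<close>; the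
    others are zero anyway.\<close>
  have col: "X (a, j) * (c - ?s c) \<in> ?W" if j: "j \<in> C" for j c
  proof -
    have "X v \<in> {p. X (a, j) * p \<in> ?W}" if v: "v \<in> - (R \<times> (C - {b}))" for v
    proof (cases "v \<in> R \<times> C")
      case True
      then obtain i where i: "v = (i, b)" using v by auto
      have "X (a, j) * X (i, b) = minor2 a i j b + X (i, j) * (X (a, b) :: 'k mpoly)"
        by (simp add: minor2_def algebra_simps)
      moreover have "minor2 a i j b \<in> ?W" "X (i, j) * X (a, b) \<in> ?W"
        by (simp_all add: minor2_in_minor_ideal X_in_minor_ideal rid.subspace_scale)
      ultimately show ?thesis using rid.subspace_add[OF Ideal_minor_ideal] by (simp add: i)
    next
      case False
      then show ?thesis by (simp add: X_in_minor_ideal rid.subspace_scale)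
    qed
    then have "c - ?s c \<in> {p. X (a, j) * p \<in> ?W}"
      by (intro kill_diff_in[OF Ideal_colon[OF Ideal_minor_ideal]])
    then show ?thesis by simp
  qed
  show "?Y1 \<inter> ?Y2 \<subseteq> ?W"
    unfolding minor_ideal_def[of UNIV "- ((R - {a}) \<times> C)"]
  proof (rule kill_Int_subset)
    show "?W \<subseteq> ?Y2" by (intro minor_ideal_mono) auto
    show "?s y \<in> ?W" if "y \<in> ?Y2" for y
      using kill_minor_ideal[OF that, of "insert (a, b) (- (R \<times> C))"]
        minor_ideal_mono[of "UNIV \<inter> (C - {b}) \<times> (C - {b})" UNIV "insert (a, b) (- (R \<times> C))"] by auto
    fix x c :: "'k mpoly"
    assume x: "x \<in> X ` (- ((R - {a}) \<times> C)) \<union> {minor2 i j k l | i j k l. (k, l) \<in> UNIV}"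
    show "\<exists>w. c * x - ?s w \<in> ?W"
    proof (cases "\<exists>j\<in>C - {b}. x = X (a, j)")
      case True
      then obtain j where j: "j \<in> C - {b}" "x = X (a, j)" by blast
      have "?s (X (a, j) * c) = X (a, j) * ?s c"
        using j(1) assms by (simp add: kill_mult kill_X)
      then have "c * x - ?s (X (a, j) * c) = X (a, j) * (c - ?s c)"
        by (simp add: j(2) algebra_simps)
      then have "c * x - ?s (X (a, j) * c) \<in> ?W" using col[of j c] j(1) by simp
      then show ?thesis by blast
    next
      case False
      then have "x \<in> ?W" using x by (auto intro: X_in_minor_ideal minor2_in_minor_ideal)
      then have "c * x - ?s 0 \<in> ?W" by (simp add: kill_def rid.subspace_scale)
      then show ?thesis by blast
    qed
  qed simp_all
qed

text \<open>Modulo \<open>?W\<close>, a minor with both columns in \<open>V\<close> is annihilated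
  by every variable outside \<open>V\<close>. A multiple of it thus depends only on what
  \<open>?s\<close> leaves of the coefficient, which is the situation of
  \<open>kill_Int_subset\<close>.\<close>

lemma minor_ideal_Int_block:
  assumes "V \<subseteq> C" and E: "\<And>j l. j \<in> V \<Longrightarrow> l \<in> C - V \<Longrightarrow> (j, l) \<in> E \<and> (l, j) \<in> E"
  shows "minor_ideal E (- (R \<times> C)) \<inter> minor_ideal {} (- (R \<times> V)) = (minor_ideal (E - V \<times> V) (- (R \<times> C)) :: 'k::field mpoly set)"
    (is "?Y1 \<inter> ?Y2 = ?W")
proof
  have W_Y2: "?W \<subseteq> ?Y2"
  proof (rule minor_ideal_least)
    fix i j k l assume "(k, l) \<in> E - V \<times> V"
    then have "(X (i, k) \<in> ?Y2 \<and> X (j, k) \<in> ?Y2) \<or> (X (i, l) \<in> ?Y2 \<and> X (j, l) \<in> ?Y2)"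
      by (auto intro: X_in_minor_ideal)
    then show "minor2 i j k l \<in> ?Y2"
      unfolding minor2_def
      by (auto intro!: rid.subspace_diff[OF Ideal_minor_ideal] intro: rid.subspace_scale Ideal_mult_right)
  qed (use assms(1) in \<open>auto intro: X_in_minor_ideal\<close>)
  show "?W \<subseteq> ?Y1 \<inter> ?Y2" using W_Y2 minor_ideal_mono[of "E - V \<times> V" E] by blast
  let ?s = "kill (- (R \<times> V)) :: 'k mpoly \<Rightarrow> 'k mpoly"
  have col: "minor2 i j k l * (c - ?s c) \<in> ?W" if kl: "k \<in> V" "l \<in> V" for i j k l c
  proof -
    have "X v \<in> {p. minor2 i j k l * p \<in> ?W}" if v: "v \<in> - (R \<times> V)" for v
    proof (cases "v \<in> R \<times> C")
      case True
      then obtain q t where qt: "v = (q, t)" "t \<in> C - V" using v by auto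
      \<comment> \<open>Exchange path from \<open>X (i, k) * X (j, l) * X (q, t)\<close> to
        \<open>X (i, l) * X (j, k) * X (q, t)\<close>: each of its three steps uses a minor that
        pairs the outside column \<open>t\<close> with a column of \<open>V\<close>.\<close>
      have "minor2 i j k l * X (q, t) = X (j, l) * minor2 q i t k
          + X (q, k) * minor2 i j t l + X (i, l) * (minor2 q j k t :: 'k mpoly)"
        by (simp add: minor2_def algebra_simps)
      moreover have "X (j, l) * minor2 q i t k \<in> ?W" "X (q, k) * minor2 i j t l \<in> ?W"
        "X (i, l) * minor2 q j k t \<in> ?W"
        using E kl qt by (auto intro!: rid.subspace_scale minor2_in_minor_ideal)
      ultimately show ?thesis by (simp add: qt(1) rid.subspace_add)
    next
      case False
      then show ?thesis by (simp add: X_in_minor_ideal rid.subspace_scale)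
    qed
    then have "c - ?s c \<in> {p. minor2 i j k l * p \<in> ?W}"
      by (intro kill_diff_in[OF Ideal_colon[OF Ideal_minor_ideal]])
    then show ?thesis by simp
  qed
  show "?Y1 \<inter> ?Y2 \<subseteq> ?W"
    unfolding minor_ideal_def[of E]
  proof (rule kill_Int_subset)
    show "?W \<subseteq> ?Y2" by (rule W_Y2)
    show "?s y \<in> ?W" if "y \<in> ?Y2" for y
      using kill_minor_ideal[OF that, of "- (R \<times> C)"] minor_ideal_mono[of "{}" "E - V \<times> V" "- (R \<times> C)"] by auto
    fix x c :: "'k mpoly"
    assume x: "x \<in> X ` (- (R \<times> C)) \<union> {minor2 i j k l | i j k l. (k, l) \<in> E}"
    show "\<exists>w. c * x - ?s w \<in> ?W"
    proof (cases "x \<in> ?W")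
      case True
      then have "c * x - ?s 0 \<in> ?W" by (simp add: kill_def rid.subspace_scale)
      then show ?thesis by blast
    next
      case False
      then have "x \<notin> X ` (- (R \<times> C))" using X_in_minor_ideal[of _ "- (R \<times> C)"] by blast
      then obtain i j k l where ijkl: "x = minor2 i j k l" "(k, l) \<in> E"
        using x by blast
      with False have kl: "k \<in> V" "l \<in> V" using minor2_in_minor_ideal[of k l "E - V \<times> V"] by auto
      show ?thesis
      proof (cases "i \<in> R \<and> j \<in> R")
        case True
        then have "?s (minor2 i j k l * c) = minor2 i j k l * ?s c"
          using kl by (simp add: kill_mult kill_minor2)
        then have "c * x - ?s (minor2 i j k l * c) = minor2 i j k l * (c - ?s c)"
          by (simp add: ijkl(1) algebra_simps)
        then have "c * x - ?s (minor2 i j k l * c) \<in> ?W" using col[OF kl] by simp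
        then show ?thesis by blast
      next
        assume "\<not> (i \<in> R \<and> j \<in> R)"
        then have "(X (i, k) \<in> ?W \<and> X (i, l) \<in> ?W) \<or> (X (j, k) \<in> ?W \<and> X (j, l) \<in> ?W)"
          by (auto intro: X_in_minor_ideal)
        then have "minor2 i j k l \<in> ?W"
          unfolding minor2_def
          by (auto intro!: rid.subspace_diff[OF Ideal_minor_ideal] intro: rid.subspace_scale Ideal_mult_right)
        with False ijkl(1) show ?thesis by simp
      qed
    qed
  qed simp_all
qed

text \<open>If a minor uses a column outside \<open>V\<close>, both of its products contain a
  variable put to zero.\<close>

lemma minor_ideal_block_complete:
  assumes "V \<times> V \<subseteq> E"
  shows "minor_ideal E (- (R \<times> V)) = minor_ideal UNIV (- (R \<times> V))"
proof
  show "minor_ideal UNIV (- (R \<times> V)) \<subseteq> minor_ideal E (- (R \<times> V))"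
  proof (rule minor_ideal_least)
    fix i j k l
    let ?Y = "minor_ideal E (- (R \<times> V))"
    show "minor2 i j k l \<in> ?Y"
    proof (cases "(k, l) \<in> V \<times> V")
      case False
      then have "(X (i, k) \<in> ?Y \<and> X (j, k) \<in> ?Y) \<or> (X (i, l) \<in> ?Y \<and> X (j, l) \<in> ?Y)"
        by (auto intro: X_in_minor_ideal)
      then show ?thesis
        unfolding minor2_def
        by (auto intro!: rid.subspace_diff[OF Ideal_minor_ideal] intro: rid.subspace_scale Ideal_mult_right)
    qed (use assms in \<open>auto intro: minor2_in_minor_ideal\<close>)
  qed (auto intro: X_in_minor_ideal)
qed (intro minor_ideal_mono; simp)

section \<open>Antidiagonal sums on rank one matrices\<close>

definition diag :: "nat \<Rightarrow> nat \<Rightarrow> nat \<Rightarrow> 'k::field mpoly" where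
  "diag m n c = (\<Sum>v | v \<in> {1..m} \<times> {1..n} \<and> fst v + snd v = c. X v)"

lemma homog_diag [simp]: "homog (Suc 0) (diag m n c)"
  unfolding diag_def by (intro homog_sum homog_X)

text \<open>Induction on the size of the block through its corner \<open>X (a, b)\<close>. Dividing
  by the corner gives the intersection of the blocks without row \<open>a\<close> and without column
  \<open>b\<close>, whose sum lacks both, so \<open>reg_Int\<close> applies. Then the corner is
  moved to the end, where it is congruent to \<open>diag m n (a + b)\<close>, being the only cell of
  the block on that antidiagonal.\<close>

lemma reg_diag:
  assumes "1 \<le> a" "a \<le> m" "1 \<le> b" "b \<le> e" "e \<le> n"
  shows "reg (minor_ideal UNIV (- ({a..m} \<times> {b..e})) :: 'k::field mpoly set)
           (map (diag m n) (rev [a + b..<Suc (m + e)]))"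
  using assms
proof (induction "(m - a) + (e - b)" arbitrary: a b rule: less_induct)
  case less
  let ?Y = "minor_ideal UNIV (- ({a..m} \<times> {b..e})) :: 'k mpoly set"
  let ?x = "X (a, b) :: 'k mpoly"
  let ?L = "map (diag m n) (rev [Suc (a + b)..<Suc (m + e)]) :: 'k mpoly list"
  have adjoin: "adjoin ?Y ?x = minor_ideal UNIV (insert (a, b) (- ({a..m} \<times> {b..e})))" by (rule adjoin_minor_ideal)
  have R: "{a..m} - {a} = {Suc a..m}" and C: "{b..e} - {b} = {Suc b..e}" by auto
  have "reg (adjoin ?Y ?x) ?L"
  proof (cases "a = m \<or> b = e")
    case True
    \<comment> \<open>A single row or column: dividing by the corner just shortens it, and in the
      first case \<open>?L\<close> is empty.\<close>
    consider "a = m" "b = e" | "a = m" "b < e" | "a < m" "b = e" using True less.prems by linarith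
    then show ?thesis
    proof cases
      case 2
      have "insert (a, b) (- ({a..m} \<times> {b..e})) = - ({a..m} \<times> {Suc b..e})" using 2 less.prems by auto
      moreover have "reg (minor_ideal UNIV (- ({a..m} \<times> {Suc b..e})) :: 'k mpoly set)
          (map (diag m n) (rev [a + Suc b..<Suc (m + e)]))"
        by (rule less.hyps) (use less.prems 2 in auto)
      ultimately show ?thesis by (simp only: adjoin add_Suc_right)
    next
      case 3
      have "insert (a, b) (- ({a..m} \<times> {b..e})) = - ({Suc a..m} \<times> {b..e})" using 3 less.prems by auto
      moreover have "reg (minor_ideal UNIV (- ({Suc a..m} \<times> {b..e})) :: 'k mpoly set)
          (map (diag m n) (rev [Suc a + b..<Suc (m + e)]))"
        by (rule less.hyps) (use less.prems 3 in auto)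
      ultimately show ?thesis by (simp only: adjoin add_Suc)
    qed simp
  next
    case False
    then have lt: "a < m" "b < e" using less.prems by auto
    let ?Y1 = "minor_ideal UNIV (- ({Suc a..m} \<times> {b..e})) :: 'k mpoly set"
    let ?Y2 = "minor_ideal UNIV (- ({a..m} \<times> {Suc b..e})) :: 'k mpoly set"
    let ?M = "map (diag m n) (rev [Suc (Suc (a + b))..<Suc (m + e)]) :: 'k mpoly list"
    \<comment> \<open>The descending order puts last the one antidiagonal that meets the two smaller
      blocks but not the block without row \<open>a\<close> and column \<open>b\<close>.\<close>
    have L: "?L = ?M @ [diag m n (Suc (a + b))]" using lt by (subst upt_conv_Cons) auto
    have sum: "ideal_sum ?Y1 ?Y2 = minor_ideal UNIV (- ({Suc a..m} \<times> {Suc b..e}))"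
    proof -
      have "- ({Suc a..m} \<times> {b..e}) \<union> - ({a..m} \<times> {Suc b..e}) = - ({Suc a..m} \<times> {Suc b..e})" by auto
      then show ?thesis by (simp only: ideal_sum_minor_ideal Un_absorb)
    qed
    have "?Y1 \<inter> ?Y2 = adjoin ?Y ?x"
      using minor_ideal_row_Int_col[of a "{a..m}" b "{b..e}"] less.prems unfolding adjoin R C by simp
    moreover have "reg (?Y1 \<inter> ?Y2) (?M @ [diag m n (Suc (a + b))])"
    proof (rule reg_Int)
      show "reg ?Y1 (?M @ [diag m n (Suc (a + b))])"
        using less.hyps[of "Suc a" b] less.prems lt unfolding L[symmetric] add_Suc by simp
      show "reg ?Y2 (?M @ [diag m n (Suc (a + b))])"
        using less.hyps[of a "Suc b"] less.prems lt unfolding L[symmetric] add_Suc_right by simp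
      show "reg (ideal_sum ?Y1 ?Y2) ?M"
        unfolding sum using less.hyps[of "Suc a" "Suc b"] less.prems lt
        unfolding add_Suc add_Suc_right by simp
    qed simp_all
    ultimately show ?thesis by (simp only: L)
  qed
  moreover have "nzd ?x ?Y" using less.prems by (intro nzd_X_Segre) auto
  ultimately have "reg ?Y (?x # ?L)" by simp
  then have "reg ?Y (?L @ [?x])"
    by (rule reg_perm[OF hIdeal_minor_ideal, rotated 2]) auto
  then have "reg ?Y ?L" and x: "reg (adjoin_list ?Y ?L) [?x]" by (simp_all only: reg_append)
  moreover have "?x - diag m n (a + b) \<in> ?Y"
  proof -
    let ?D = "{v \<in> {1..m} \<times> {1..n}. fst v + snd v = a + b}"
    have "finite ?D" by (rule finite_subset[of _ "{1..m} \<times> {1..n}"]) auto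
    moreover have "(a, b) \<in> ?D" using less.prems by auto
    ultimately have "diag m n (a + b) = ?x + (\<Sum>v\<in>?D - {(a, b)}. X v)"
      unfolding diag_def by (simp add: sum.remove)
    moreover have "(\<Sum>v\<in>?D - {(a, b)}. X v) \<in> ?Y"
      by (intro rid.subspace_sum X_in_minor_ideal) auto
    ultimately show ?thesis using rid.subspace_neg[of ?Y] by simp
  qed
  then have "?x - diag m n (a + b) \<in> adjoin_list ?Y ?L" using adjoin_list_superset[OF Ideal_minor_ideal] by blast
  then have "reg (adjoin_list ?Y ?L) [diag m n (a + b)]"
    by (intro reg_cong[OF Ideal_adjoin_list[OF Ideal_minor_ideal] _ x]) simp
  ultimately have "reg ?Y (?L @ [diag m n (a + b)])" by (simp only: reg_append)
  moreover have "map (diag m n) (rev [a + b..<Suc (m + e)]) = ?L @ [diag m n (a + b) :: 'k mpoly]"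
    using less.prems by (subst upt_conv_Cons) auto
  ultimately show ?case by (simp only:)
qed

section \<open>A common regular sequence\<close>

text \<open>The diagonal sums are collected modulo \<open>D\<close> so that a single sequence serves all blocks of
  consecutive columns at once.\<close>

definition cyclic_diag :: "nat \<Rightarrow> nat \<Rightarrow> nat \<Rightarrow> nat \<Rightarrow> 'k::field mpoly" where
  "cyclic_diag m n D c = (\<Sum>v | v \<in> {1..m} \<times> {1..n} \<and> (fst v + snd v) mod D = c mod D. X v)"

lemma homog_cyclic_diag [simp]: "homog (Suc 0) (cyclic_diag m n D c)"
  unfolding cyclic_diag_def using homog_X by (intro homog_sum) simp

lemma cyclic_diag_periodic [simp]: "cyclic_diag m n D (c + D) = cyclic_diag m n D c"
  by (simp add: cyclic_diag_def)

lemma mset_map_periodic: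
  assumes "\<And>c. f (c + D) = f c"
  shows "mset (map f [k..<k + D]) = mset (map f [0..<D])"
proof (induction k)
  case (Suc k)
  show ?case
  proof (cases "D = 0")
    case False
    have "[k..<k + D] = k # [Suc k..<k + D]" using False by (simp add: upt_conv_Cons)
    moreover have "[Suc k..<Suc k + D] = [Suc k..<k + D] @ [k + D]" using False by simp
    ultimately have "mset (map f [Suc k..<Suc k + D]) = mset (map f [k..<k + D])"
      by (simp only: map_append mset_append list.map assms mset.simps) simp
    then show ?thesis using Suc by simp
  qed simp
qed simp

lemma mod_window:
  fixes c c' :: nat
  assumes "k \<le> c" "c < k + D" "k \<le> c'" "c' < k + D" "c mod D = c' mod D"
  shows "c = c'"
  using assms
proof (induction c c' rule: linorder_wlog)
  case (le c c')
  then have "D dvd c' - c" using mod_eq_dvd_iff_nat[of c c' D] by simp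
  moreover have "c' - c < D" using le by linarith
  ultimately show ?case using le(1) nat_dvd_not_less[of "c' - c" D] by fastforce
qed auto

lemma cyclic_diag_eq_sum_diag:
  "cyclic_diag m n D c = (\<Sum>c' | c' \<le> m + n \<and> c' mod D = c mod D. diag m n c')"
proof -
  let ?A = "{v \<in> {1..m} \<times> {1..n}. (fst v + snd v) mod D = c mod D}"
  let ?S = "{c'. c' \<le> m + n \<and> c' mod D = c mod D}"
  have fin: "finite ?A" by (rule finite_subset[of _ "{1..m} \<times> {1..n}"]) auto
  have "cyclic_diag m n D c = (\<Sum>c'\<in>?S. \<Sum>v\<in>{v\<in>?A. fst v + snd v = c'}. X v)"
    unfolding cyclic_diag_def using fin by (intro sum.group[symmetric]) auto
  also have "\<dots> = (\<Sum>c'\<in>?S. diag m n c')"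
    unfolding diag_def by (intro sum.cong) auto
  finally show ?thesis .
qed

lemma diag_in_minor_ideal:
  assumes "c \<le> b \<or> m + e < c"
  shows "diag m n c \<in> minor_ideal E (- ({1..m} \<times> {b..e}))"
  unfolding diag_def by (intro rid.subspace_sum X_in_minor_ideal) (use assms in auto)

text \<open>The block meets the antidiagonals \<open>1 + b\<close> to \<open>m + e\<close>. In the
  window of length \<open>D\<close> from \<open>1 + b\<close> only \<open>c\<close> has its residue;
  every other antidiagonal of the cyclic sum misses the block or is one of the upper ones already
  adjoined.\<close>

lemma diag_cyclic_diag_cong:
  assumes be: "1 \<le> b" "b \<le> e" "e \<le> n" and D: "D \<le> m + e - b"
    and c: "1 + b \<le> c" "c < 1 + b + D"
  shows "diag m n c - cyclic_diag m n D c \<in> adjoin_list (minor_ideal UNIV (- ({1..m} \<times> {b..e})) :: 'k::field mpoly set)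
    (map (diag m n) (rev [1 + b + D..<Suc (m + e)]))"
proof -
  let ?Y = "minor_ideal UNIV (- ({1..m} \<times> {b..e})) :: 'k mpoly set"
  let ?l = "map (diag m n) (rev [1 + b + D..<Suc (m + e)]) :: 'k mpoly list"
  let ?S = "{c'. c' \<le> m + n \<and> c' mod D = c mod D}"
  have "c \<in> ?S" "finite ?S" using c D be by auto
  then have "cyclic_diag m n D c = diag m n c + (\<Sum>c'\<in>?S - {c}. diag m n c' :: 'k mpoly)"
    unfolding cyclic_diag_eq_sum_diag by (simp add: sum.remove)
  moreover have "(\<Sum>c'\<in>?S - {c}. diag m n c') \<in> adjoin_list ?Y ?l"
  proof (rule rid.subspace_sum[OF Ideal_adjoin_list[OF Ideal_minor_ideal]])
    fix c' assume c': "c' \<in> ?S - {c}"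
    have "\<not> (1 + b \<le> c' \<and> c' < 1 + b + D)"
    proof
      assume "1 + b \<le> c' \<and> c' < 1 + b + D"
      then have "c = c'"
        using mod_window[of "1 + b" c D c'] c c' by simp
      with c' show False by simp
    qed
    then consider "c' \<le> b \<or> m + e < c'" | "1 + b + D \<le> c'" "c' \<le> m + e" by linarith
    then show "diag m n c' \<in> adjoin_list ?Y ?l"
    proof cases
      case 1
      then show ?thesis using diag_in_minor_ideal adjoin_list_superset[OF Ideal_minor_ideal] by blast
    next
      case 2
      then show ?thesis by (intro adjoin_list_base) (auto simp del: upt_Suc)
    qed
  qed
  ultimately show ?thesis using rid.subspace_neg[OF Ideal_adjoin_list[OF Ideal_minor_ideal]] by fastforce
qed

text \<open>With the uppermost antidiagonals adjoined first, the remaining \<open>D\<close> become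
  congruent to cyclic sums; then the list is reordered. The upper antidiagonals stay in it because
  the full matrix draws its last element from them.\<close>

lemma reg_cyclic_diag_block:
  assumes m: "1 \<le> m" and be: "1 \<le> b" "b \<le> e" "e \<le> n" and D: "D \<le> m + e - b"
  shows "reg (minor_ideal UNIV (- ({1..m} \<times> {b..e})) :: 'k::field mpoly set)
    (map (cyclic_diag m n D) [0..<D] @ map (diag m n) [1 + b + D..<Suc (m + e)])"
proof -
  let ?Y = "minor_ideal UNIV (- ({1..m} \<times> {b..e})) :: 'k mpoly set"
  let ?l = "map (diag m n) (rev [1 + b + D..<Suc (m + e)]) :: 'k mpoly list"
  let ?g = "map (diag m n) (rev [1 + b..<1 + b + D]) :: 'k mpoly list"
  let ?h = "map (cyclic_diag m n D) (rev [1 + b..<1 + b + D]) :: 'k mpoly list"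
  have "[1 + b..<Suc (m + e)] = [1 + b..<1 + b + D] @ [1 + b + D..<Suc (m + e)]"
    using D be upt_add_eq_append[of "1 + b" "1 + b + D" "Suc (m + e) - (1 + b + D)"] by simp
  then have "map (diag m n) (rev [1 + b..<Suc (m + e)]) = ?l @ ?g" by (simp only: rev_append map_append)
  moreover have "reg ?Y (map (diag m n) (rev [1 + b..<Suc (m + e)]))"
    by (rule reg_diag) (use m be in auto)
  ultimately have "reg ?Y (?l @ ?g)" by (simp only:)
  then have l: "reg ?Y ?l" and g: "reg (adjoin_list ?Y ?l) ?g" by (simp_all only: reg_append)
  have "list_all2 (\<lambda>x y. x - y \<in> adjoin_list ?Y ?l) ?g ?h"
    unfolding list.rel_map list_all2_same set_rev set_upt
    by (intro ballI diag_cyclic_diag_cong[OF be D]) (simp_all only: atLeastLessThan_iff)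
  then have "reg (adjoin_list ?Y ?l) ?h"
    using g by (rule reg_cong[OF Ideal_adjoin_list[OF Ideal_minor_ideal]])
  with l have reg: "reg ?Y (?l @ ?h)" by (simp only: reg_append)
  have "mset ?h = mset (map (cyclic_diag m n D) [0..<D])"
    using mset_map_periodic[where f = "cyclic_diag m n D" and D = D and k = "1 + b", OF cyclic_diag_periodic]
    by (simp only: rev_map[symmetric] mset_rev)
  then have mset: "mset (?l @ ?h) = mset (map (cyclic_diag m n D) [0..<D] @ map (diag m n) [1 + b + D..<Suc (m + e)])"
    by (simp only: rev_map[symmetric] mset_rev mset_append add.commute)
  have "\<forall>f\<in>set (?l @ ?h). homog (Suc 0) f" by (auto simp del: upt_Suc)
  from reg_perm[OF hIdeal_minor_ideal this mset reg] show ?thesis .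
qed

text \<open>Modulo the variables outside the block, the cyclic sums are linear forms in disjoint
  sets of variables. Solving each for a pivot leaves a polynomial ring, so every \<open>f\<close>
  outside the ideal is regular; \<open>\<zeta>\<close> certifies that it is outside.\<close>

lemma reg_cyclic_diag_poly:
  fixes f :: "'k::field mpoly"
  assumes m: "1 \<le> m" and be: "1 \<le> b" "b \<le> e" "e \<le> n" and D: "D \<le> m + e - b"
    and \<zeta>: "\<And>v. v \<notin> {1..m} \<times> {b..e} \<Longrightarrow> \<zeta> v = 0" "\<And>c. subst \<zeta> (cyclic_diag m n D c) = 0" "subst \<zeta> f \<noteq> 0"
  shows "reg (minor_ideal {} (- ({1..m} \<times> {b..e}))) (map (cyclic_diag m n D) [0..<D] @ [f])"
proof -
  let ?B = "{1..m} \<times> {b..e}"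
  let ?P = "minor_ideal {} (- ?B) :: 'k mpoly set"
  let ?c = "cyclic_diag m n D :: nat \<Rightarrow> 'k mpoly"
  define cls where "cls c = {v \<in> ?B. (fst v + snd v) mod D = c}" for c
  define all where "all c = {v \<in> {1..m} \<times> {1..n}. (fst v + snd v) mod D = c}" for c
  have fin: "finite (cls c)" "finite (all c)" for c
    unfolding cls_def all_def by (rule finite_subset[of _ "{1..m} \<times> {1..n}"], use be in auto)+
  have sub: "cls c \<subseteq> all c" for c using be by (auto simp: cls_def all_def)
  have c_all: "?c c = (\<Sum>v\<in>all c. X v)" if "c < D" for c
    using that by (simp add: cyclic_diag_def all_def)
  have out: "v \<notin> ?B" if "v \<in> all c - cls c" for v c
    using that by (auto simp: cls_def all_def)
  have ex: "\<exists>v. v \<in> cls c" if c: "c < D" for c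
  proof -
    have D0: "0 < D" using c by simp
    obtain t where t: "1 + b \<le> t" "t < 1 + b + D" "t mod D = c"
    proof
      \<comment> \<open>The representative of \<open>c\<close> in the window from
        \<open>1 + b\<close>; the multiple of \<open>D\<close> keeps the subtraction from
        truncating.\<close>
      let ?t = "(1 + b) + (c + D * (1 + b) - (1 + b)) mod D"
      show "1 + b \<le> ?t" "?t < 1 + b + D" using D0 by simp_all
      have "1 + b \<le> D * (1 + b)" using D0 by (cases D) auto
      then have "(1 + b) + (c + D * (1 + b) - (1 + b)) = c + D * (1 + b)" by linarith
      then have "?t mod D = (c + D * (1 + b)) mod D" by (simp only: mod_add_right_eq)
      then show "?t mod D = c" using c by (simp only: mod_mult_self2 mod_less)
    qed
    \<comment> \<open>The lowest cell of the block on antidiagonal \<open>t\<close>, that is, the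
      one with the largest row index.\<close>
    define i where "i = min m (t - b)"
    have "(i, t - i) \<in> cls c"
      using t m be D unfolding cls_def i_def by (auto simp: min_def)
    then show ?thesis by blast
  qed
  define piv where "piv c = (SOME v. v \<in> cls c)" for c
  have piv: "piv c \<in> cls c" if "c < D" for c
    unfolding piv_def using ex[OF that] by (rule someI_ex)
  define Q where "Q d = adjoin_list ?P (map ?c [0..<d])" for d
  have Q_gen: "Q d = gen (?c ` {0..<d} \<union> X ` (- ?B))" for d
    by (simp add: Q_def minor_ideal_def adjoin_list_gen)
  have Q_Ideal: "Ideal (Q d)" for d by (simp add: Q_gen)
  have Q_X: "X v \<in> Q d" if "v \<notin> ?B" for v d
    unfolding Q_gen using that by (intro rid.span_base) auto
  have Q_c: "?c c \<in> Q d" if "c < d" for c d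
    unfolding Q_gen using that by (intro rid.span_base) auto
  have Q_vanish: "subst h y = 0"
    if "y \<in> Q d" "\<And>v. v \<notin> ?B \<Longrightarrow> h v = 0" "\<And>c. c < d \<Longrightarrow> subst h (?c c) = 0" for h y d
    using subst_in_gen[of y _ h "{0}"] that unfolding Q_gen by fastforce
  have kernel: "nzd q (Q d)" if d: "d \<le> D" and q: "q \<notin> Q d" for d q
  proof (rule nzd_kernel[OF _ q])
    \<comment> \<open>Solves \<open>?c c = 0\<close> for the pivot of each class below
      \<open>d\<close> and sets the variables outside the block to zero.\<close>
    define g where "g v = (if v \<notin> ?B then 0
        else let c = (fst v + snd v) mod D in
          if c < d \<and> v = piv c then - (\<Sum>w\<in>cls c - {v}. X w) else (X v :: 'k mpoly))" for v
    have g_piv: "g (piv c) = - (\<Sum>w\<in>cls c - {piv c}. X w)" if "c < d" for c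
      using piv[of c] that d by (simp add: g_def cls_def)
    have g_other: "g v = X v" if "v \<in> cls c - {piv c}" for v c
      using that by (auto simp: g_def cls_def Let_def)
    have cls_sum: "(\<Sum>v\<in>all c. h v) = h (piv c) + (\<Sum>v\<in>cls c - {piv c}. h v) + (\<Sum>v\<in>all c - cls c. h v)"
      if "c < d" for h :: "nat \<times> nat \<Rightarrow> 'k mpoly" and c
      using piv[of c] that d fin sub by (simp add: sum.remove sum.subset_diff[of "cls c" "all c"])
    show "p \<in> Q d \<longleftrightarrow> subst g p = 0" for p
    proof (rule mem_kernel_iff[OF Q_Ideal])
      fix v
      show "g v - X v \<in> Q d"
      proof (cases "v \<in> ?B")
        case False
        then show ?thesis using Q_X[OF False] by (simp add: g_def rid.subspace_neg[OF Q_Ideal])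
      next
        case True
        show ?thesis
        proof (cases "(fst v + snd v) mod D < d \<and> v = piv ((fst v + snd v) mod D)")
          case True
          define c where "c = (fst v + snd v) mod D"
          have c: "c < d" "v = piv c" using True by (simp_all add: c_def)
          have "g v - X v = - ?c c + (\<Sum>w\<in>all c - cls c. X w)"
            using c_all[of c] cls_sum[OF c(1), of X] c d by (simp add: g_piv)
          moreover have "(\<Sum>w\<in>all c - cls c. X w) \<in> Q d"
            using out by (intro rid.subspace_sum[OF Q_Ideal] Q_X)
          ultimately show ?thesis
            using rid.subspace_add[OF Q_Ideal rid.subspace_neg[OF Q_Ideal Q_c[OF c(1)]]] by simp
        next
          case False
          then show ?thesis using \<open>v \<in> ?B\<close> by (auto simp: g_def Let_def rid.subspace_0[OF Q_Ideal])
        qed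
      qed
    next
      fix y assume y: "y \<in> Q d"
      show "subst g y = 0"
      proof (rule Q_vanish[OF y])
        show "g v = 0" if "v \<notin> ?B" for v using that by (simp add: g_def)
        then have 0: "(\<Sum>v\<in>all c - cls c. g v) = 0" for c
          using out[of _ c] by (intro sum.neutral) blast
        show "subst g (?c c) = 0" if "c < d" for c
          using c_all[of c] cls_sum[OF that, of g] that d 0[of c] g_other[of _ c]
          by (simp add: g_piv)
      qed
    qed
  qed
  have step: "reg ?P (map ?c [0..<d])" if "d \<le> D" for d
    using that
  proof (induction d)
    case (Suc d)
    have "?c d \<notin> Q d"
    proof
      assume mem: "?c d \<in> Q d"
      \<comment> \<open>The indicator of the pivot of class \<open>d\<close> kills the generators of
        \<open>Q d\<close> and sends \<open>?c d\<close> to \<open>1\<close>.\<close>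
      define h where "h v = (if v = piv d then 1 else 0 :: 'k mpoly)" for v
      have p: "piv d \<in> cls d" using piv[of d] Suc.prems by simp
      have val: "subst h (?c c) = (if c = d then 1 else 0)" if "c < D" for c
        using p sub[of d] that fin by (auto simp: c_all h_def all_def)
      have "subst h (?c d) = 0"
        using p val Suc.prems by (intro Q_vanish[OF mem]) (auto simp: h_def cls_def)
      then show False using val[of d] Suc.prems by simp
    qed
    then have "nzd (?c d) (Q d)" using Suc.prems by (intro kernel) auto
    then show ?case using Suc by (simp add: reg_append Q_def)
  qed simp
  have "f \<notin> Q D"
    using Q_vanish[of f D \<zeta>] \<zeta> by blast
  then have "nzd f (Q D)" by (intro kernel) auto
  then show ?thesis using step[of D] by (simp add: reg_append Q_def)
qed

section \<open>The socle of a block\<close>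

lemma ideal_elements_closed: "Ideal Y \<Longrightarrow> Ideal {a. a * u \<in> Y}"
  using Ideal_colon[of Y u] by (simp add: mult.commute)

text \<open>Starting from \<open>1\<close>, run through the variables by increasing index sum and
  multiply \<open>u\<close> by \<open>X v\<close> whenever the product stays outside
  \<open>T\<close>. By \<open>sq\<close> the product is killed by \<open>X v\<close>, and what
  killed \<open>u\<close> still kills it.\<close>

lemma greedy_socle:
  fixes T :: "'k::field mpoly set"
  assumes T: "Ideal T" "1 \<notin> T"
    and sq: "\<And>v u. (\<And>w. fst w + snd w < fst v + snd v \<Longrightarrow> X w * u \<in> T) \<Longrightarrow> X v * (X v * u) \<in> T"
  shows "\<exists>u. u \<notin> T \<and> (\<forall>v. fst v + snd v < c \<longrightarrow> X v * u \<in> T)"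
proof (induction c)
  case 0
  show ?case using T(2) by auto
next
  case (Suc c)
  have key: "\<exists>u. u \<notin> T \<and> (\<forall>v. fst v + snd v < c \<longrightarrow> X v * u \<in> T) \<and> (\<forall>v\<in>A. X v * u \<in> T)"
    if "finite A" "\<forall>v\<in>A. fst v + snd v = c" for A
    using that
  proof (induction A rule: finite_induct)
    case empty
    then show ?case using Suc by auto
  next
    case (insert v A)
    then obtain u where u: "u \<notin> T" "\<And>v. fst v + snd v < c \<Longrightarrow> X v * u \<in> T" "\<And>v. v \<in> A \<Longrightarrow> X v * u \<in> T"
      by auto
    show ?case
    proof (cases "X v * u \<in> T")
      case True
      then show ?thesis using u by auto
    next
      case False
      have "X w * (X v * u) \<in> T" if "X w * u \<in> T" for w
        using rid.subspace_scale[OF T(1) that, of "X v"] by (simp add: mult.left_commute)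
      moreover have "X v * (X v * u) \<in> T"
        using sq[of v u] u(2) insert.prems by auto
      ultimately show ?thesis using False u(2,3) by (intro exI[of _ "X v * u"]) auto
    qed
  qed
  have "finite {v :: nat \<times> nat. fst v + snd v = c}"
    by (rule finite_subset[of _ "{..c} \<times> {..c}"]) auto
  from key[OF this] obtain u where "u \<notin> T" "\<forall>v. fst v + snd v < c \<longrightarrow> X v * u \<in> T"
    "\<forall>v\<in>{v. fst v + snd v = c}. X v * u \<in> T"
    by auto
  then show ?case by (intro exI[of _ u]) (auto simp: less_Suc_eq)
qed

text \<open>Here \<open>D\<close> is the number \<open>m + e - b\<close> of antidiagonals of the
  block, so \<open>T\<close> contains all their sums. Modulo \<open>T\<close> the square of a
  variable is therefore minus the sum of its products with the others on its antidiagonal, and up to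
  a 2-minor each such product has a factor of smaller index sum.\<close>

lemma block_socle:
  assumes be: "1 \<le> b" "b \<le> e" "e \<le> n" and m: "1 \<le> m"
  defines "T \<equiv> adjoin_list (minor_ideal UNIV (- ({1..m} \<times> {b..e})) :: 'k::field mpoly set)
      (map (cyclic_diag m n (m + e - b)) [0..<m + e - b])"
  shows "\<exists>u. u \<notin> T \<and> (\<forall>a\<in>gen (range X). a * u \<in> T)"
proof -
  let ?D = "m + e - b"
  let ?B = "{1..m} \<times> {b..e}"
  let ?Y = "minor_ideal UNIV (- ?B) :: 'k mpoly set"
  have T: "Ideal T" by (simp add: T_def Ideal_adjoin_list)
  have YT: "?Y \<subseteq> T" unfolding T_def by (rule adjoin_list_superset) simp
  have D: "0 < ?D" using be m by simp
  \<comment> \<open>The origin is a common zero of all generators, so \<open>T\<close> is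
    proper.\<close>
  have "x \<in> {x. subst (\<lambda>_. 0) x = 0}" if "x \<in> T" for x
  proof -
    have "x \<in> gen (set (map (cyclic_diag m n ?D) [0..<?D]) \<union> (X ` (- ?B) \<union> {minor2 i j k l | i j k l. (k, l) \<in> UNIV}))"
      using that by (simp only: T_def minor_ideal_def adjoin_list_gen)
    then have "subst (\<lambda>_. 0) x \<in> {0}"
      by (rule subst_in_gen) (auto simp: cyclic_diag_def minor2_def)
    then show ?thesis by simp
  qed
  then have 1: "1 \<notin> T" by fastforce
  have diag: "diag m n c \<in> T" for c
  proof (cases "c \<le> b \<or> m + e < c")
    case True
    then show ?thesis using diag_in_minor_ideal[of c b m e n UNIV] YT by blast
  next
    case False
    then have "diag m n c - cyclic_diag m n ?D c \<in> ?Y"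
      using diag_cyclic_diag_cong[of b e n ?D m c] be m by simp
    moreover have "cyclic_diag m n ?D c = cyclic_diag m n ?D (c mod ?D)" by (simp add: cyclic_diag_def)
    then have "cyclic_diag m n ?D c \<in> T" unfolding T_def using D by (intro adjoin_list_base) auto
    ultimately show ?thesis using YT Ideal_diff_iff[OF T] by blast
  qed
  have sq: "X v * (X v * u) \<in> T" if lower: "\<And>w. fst w + snd w < fst v + snd v \<Longrightarrow> X w * u \<in> T" for v u
  proof (cases "v \<in> ?B")
    case False
    then have "X v \<in> T" using YT X_in_minor_ideal[of v "- ?B" UNIV] by blast
    then show ?thesis using Ideal_mult_right[OF T] by blast
  next
    case True
    obtain i j where v: "v = (i, j)" by (cases v)
    let ?A = "{w \<in> {1..m} \<times> {1..n}. fst w + snd w = i + j}"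
    have "finite ?A" by (rule finite_subset[of _ "{1..m} \<times> {1..n}"]) auto
    moreover have "v \<in> ?A" using True be v by auto
    ultimately have "diag m n (i + j) = X v + (\<Sum>w\<in>?A - {v}. X w :: 'k mpoly)"
      unfolding diag_def by (simp add: sum.remove)
    then have "X v * (X v * u) = X v * u * diag m n (i + j) - (\<Sum>w\<in>?A - {v}. X v * X w * u)"
      by (simp add: algebra_simps sum_distrib_left)
    moreover have "X v * u * diag m n (i + j) \<in> T"
      by (rule rid.subspace_scale[OF T diag])
    moreover have "(\<Sum>w\<in>?A - {v}. X v * X w * u) \<in> T"
    proof (rule rid.subspace_sum[OF T])
      fix w assume w: "w \<in> ?A - {v}"
      obtain k l where kl: "w = (k, l)" by (cases w)
      have sum: "k + l = i + j" "l \<noteq> j" using w kl v by auto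
      \<comment> \<open>As \<open>k + l = i + j\<close> and \<open>l \<noteq> j\<close>, either
        \<open>l < j\<close> or \<open>k < i\<close>; in each case one factor has a smaller index
        sum.\<close>
      have "X (i, l) * X (k, j) * u \<in> T"
      proof (cases "l < j")
        case True
        then have "X (i, l) * u \<in> T" using lower[of "(i, l)"] v by simp
        from rid.subspace_scale[OF T this, of "X (k, j)"] show ?thesis by (simp add: mult_ac)
      next
        case False
        then have "X (k, j) * u \<in> T" using lower[of "(k, j)"] v sum by simp
        from rid.subspace_scale[OF T this, of "X (i, l)"] show ?thesis by (simp add: mult_ac)
      qed
      moreover have "minor2 i k j l * u \<in> T"
        using YT minor2_in_minor_ideal[of j l UNIV i k "- ?B"] by (intro Ideal_mult_right[OF T]) auto
      moreover have "X v * X w * u = minor2 i k j l * u + X (i, l) * X (k, j) * u"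
        by (simp add: v kl minor2_def algebra_simps)
      ultimately show "X v * X w * u \<in> T" using rid.subspace_add[OF T] by simp
    qed
    ultimately show ?thesis using rid.subspace_diff[OF T] by simp
  qed
  obtain u where u: "u \<notin> T" "\<And>v. fst v + snd v < Suc (m + e) \<Longrightarrow> X v * u \<in> T"
    using greedy_socle[OF T 1 sq] by blast
  have "X v * u \<in> T" for v
  proof (cases "v \<in> ?B")
    case True
    then show ?thesis by (intro u(2)) auto
  next
    case False
    then have "X v \<in> T" using YT X_in_minor_ideal[of v "- ?B" UNIV] by blast
    then show ?thesis by (rule Ideal_mult_right[OF T])
  qed
  then have "range X \<subseteq> {a. a * u \<in> T}" by auto
  then have "gen (range X) \<subseteq> {a. a * u \<in> T}"
    by (rule rid.span_minimal) (rule ideal_elements_closed[OF T])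
  with u(1) show ?thesis by blast
qed

section \<open>Independent blocks\<close>

text \<open>\<open>K\<close> records the parts already made independent: every pair is allowed for
  \<open>K = {}\<close>. Pairs \<open>(k, k)\<close> and columns beyond \<open>n\<close> occur too,
  but their minors are zero or lie in the ideal of the variables put to zero.\<close>

definition pairs :: "(nat \<Rightarrow> nat) \<Rightarrow> (nat \<Rightarrow> nat) \<Rightarrow> nat set \<Rightarrow> (nat \<times> nat) set" where
  "pairs b e K = {(k, l). \<not> (\<exists>q\<in>K. k \<in> {b q..e q} \<and> l \<in> {b q..e q})}"

text \<open>The minors vanish modulo \<open>I\<^sub>2\<close>, where the diagonal sum is regular; they keep the element
  nonzero on each of the blocks.\<close>

definition last_elem :: "nat \<Rightarrow> nat \<Rightarrow> nat \<Rightarrow> (nat \<Rightarrow> nat) \<Rightarrow> nat set \<Rightarrow> 'k::field mpoly" where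
  "last_elem m n D b Q = diag m n (2 + D) + (\<Sum>q\<in>Q. minor2 1 2 (b q) (Suc (b q)))"

text \<open>\<open>Q\<close> stands for the parts with at least two elements. Since
  \<open>e s - b s\<close> is one less than the size of part \<open>s\<close>, assumption
  \<open>D\<close> reads \<open>m + n_s - 1\<close>, and assumption \<open>n\<close> provides a
  column outside part \<open>s\<close>. The strict \<open>b q < e q\<close> provides both columns of
  the minor in \<open>last_elem\<close>.\<close>

locale blocks =
  fixes m n :: nat and b e :: "nat \<Rightarrow> nat" and Q :: "nat set" and s D :: nat
    and field_type :: "'k::field itself"
  assumes m: "2 \<le> m" and Q: "finite Q" "s \<in> Q"
    and be: "\<And>q. q \<in> Q \<Longrightarrow> 1 \<le> b q \<and> b q < e q \<and> e q \<le> n"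
    and disj: "\<And>p q. p \<in> Q \<Longrightarrow> q \<in> Q \<Longrightarrow> p \<noteq> q \<Longrightarrow> {b p..e p} \<inter> {b q..e q} = {}"
    and shortest: "\<And>q. q \<in> Q \<Longrightarrow> e s - b s \<le> e q - b q"
    and n: "e s - b s + 2 \<le> n"
    and D: "D = m + e s - b s"
begin

abbreviation J :: "nat set \<Rightarrow> 'k mpoly set" where
  "J K \<equiv> minor_ideal (pairs b e K) (- ({1..m} \<times> {1..n}))"

abbreviation P :: "nat \<Rightarrow> 'k mpoly set" where
  "P q \<equiv> minor_ideal {} (- ({1..m} \<times> {b q..e q}))"

abbreviation fs :: "'k mpoly list" where
  "fs \<equiv> map (cyclic_diag m n D) [0..<D]"

abbreviation g :: "'k mpoly" where
  "g \<equiv> last_elem m n D b Q"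

lemma D_le: "q \<in> Q \<Longrightarrow> D \<le> m + e q - b q"
  using shortest[of q] be[of q] be[of s] Q D by linarith

text \<open>The blocks are disjoint, so before \<open>q\<close> is inserted all pairs that involve a
  column of block \<open>q\<close> are still present. This gives the hypotheses of
  \<open>minor_ideal_Int_block\<close> and the completeness of the block in the sum.\<close>

lemma J_insert:
  assumes "q \<in> Q" "K \<subseteq> Q" "q \<notin> K"
  shows "J (insert q K) = J K \<inter> P q"
    and "ideal_sum (J K) (P q) = minor_ideal UNIV (- ({1..m} \<times> {b q..e q}))"
proof -
  have *: "k \<notin> {b p..e p}" if "k \<in> {b q..e q}" "p \<in> K" for k p
    using disj[of p q] assms that by blast
  have "pairs b e (insert q K) = pairs b e K - {b q..e q} \<times> {b q..e q}"
    by (auto simp: pairs_def)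
  moreover have "J K \<inter> P q = minor_ideal (pairs b e K - {b q..e q} \<times> {b q..e q}) (- ({1..m} \<times> {1..n}))"
  proof (rule minor_ideal_Int_block)
    show "{b q..e q} \<subseteq> {1..n}" using be[OF assms(1)] by auto
    show "(j, l) \<in> pairs b e K \<and> (l, j) \<in> pairs b e K" if "j \<in> {b q..e q}" for j l
      using *[OF that] unfolding pairs_def by blast
  qed
  ultimately show "J (insert q K) = J K \<inter> P q" by simp
  have "- ({1..m} \<times> {1..n}) \<union> - ({1..m} \<times> {b q..e q}) = - ({1..m} \<times> {b q..e q})"
    using be[OF assms(1)] by auto
  then have "ideal_sum (J K) (P q) = minor_ideal (pairs b e K) (- ({1..m} \<times> {b q..e q}))"
    by (simp only: ideal_sum_minor_ideal Un_empty_right)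
  also have "\<dots> = minor_ideal UNIV (- ({1..m} \<times> {b q..e q}))"
    by (rule minor_ideal_block_complete) (use * in \<open>unfold pairs_def, blast\<close>)
  finally show "ideal_sum (J K) (P q) = minor_ideal UNIV (- ({1..m} \<times> {b q..e q}))" .
qed

lemma reg_complete: "reg (J {}) (fs @ [g])"
proof -
  have J: "J {} = minor_ideal UNIV (- ({1..m} \<times> {1..n}))" by (simp add: pairs_def)
  have "D \<le> m + n - 1" and lt: "2 + D < Suc (m + n)" using n D be[OF Q(2)] by auto
  then have "reg (J {}) (fs @ map (diag m n) [1 + 1 + D..<Suc (m + n)])"
    unfolding J by (intro reg_cyclic_diag_block) (use m n in auto)
  \<comment> \<open>\<open>2 + D\<close> is the first antidiagonal of the full matrix after the
    \<open>D\<close> that start at index \<open>2\<close>; it exists because \<open>n\<close>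
    exceeds the size of part \<open>s\<close>.\<close>
  moreover have "[1 + 1 + D..<Suc (m + n)] = (2 + D) # [Suc (2 + D)..<Suc (m + n)]"
    using lt by (simp add: upt_conv_Cons del: upt_Suc)
  ultimately have *: "reg (J {}) fs" "nzd (diag m n (2 + D)) (adjoin_list (J {}) fs)"
    by (simp_all add: reg_append del: upt_Suc)
  have "(\<Sum>q\<in>Q. minor2 1 2 (b q) (Suc (b q))) \<in> J {}"
    unfolding J by (intro rid.subspace_sum minor2_in_minor_ideal) auto
  then have "(\<Sum>q\<in>Q. minor2 1 2 (b q) (Suc (b q))) \<in> adjoin_list (J {}) fs"
    using adjoin_list_superset[OF Ideal_minor_ideal] by blast
  then have "diag m n (2 + D) - g \<in> adjoin_list (J {}) fs"
    using rid.subspace_neg[OF Ideal_adjoin_list[OF Ideal_minor_ideal]] by (simp add: last_elem_def)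
  then have "nzd g (adjoin_list (J {}) fs)"
    using * nzd_cong[OF Ideal_adjoin_list[OF Ideal_minor_ideal]] by blast
  with * show ?thesis by (simp add: reg_append)
qed

lemma reg_coordinate:
  assumes "p \<in> Q"
  shows "reg (P p) (fs @ [g])"
proof -
  \<comment> \<open>The two nonzero entries lie on one antidiagonal and cancel in every diagonal or
    cyclic sum, while the minor of block \<open>p\<close> takes the value \<open>1\<close>. The
    minors of the other blocks vanish by disjointness.\<close>
  define z where "z v = (if v = (2, b p) then 1 else if v = (1, Suc (b p)) then - 1 else 0 :: 'k mpoly)" for v :: "nat \<times> nat"
  note bp = be[OF assms]
  have sum: "(\<Sum>v\<in>A. z v) = (if (2, b p) \<in> A then 1 else 0) - (if (1, Suc (b p)) \<in> A then 1 else 0)"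
    if "finite A" for A
  proof -
    have "(\<Sum>v\<in>A. z v) = (\<Sum>v\<in>A. (if v = (2, b p) then 1 else 0) - (if v = (1, Suc (b p)) then 1 else 0))"
      by (intro sum.cong) (auto simp: z_def)
    then show ?thesis using that by (simp add: sum_subtractf)
  qed
  have fin: "finite {v \<in> {1..m} \<times> {1..n}. \<phi> v}" for \<phi>
    by (rule finite_subset[of _ "{1..m} \<times> {1..n}"]) auto
  have c: "subst z (cyclic_diag m n D c) = 0" for c
    unfolding cyclic_diag_def subst_simps subst_X sum[OF fin] using bp m by simp
  have d: "subst z (diag m n c) = 0" for c
    unfolding diag_def subst_simps subst_X sum[OF fin] using bp m by simp
  have minor: "subst z (minor2 1 2 (b q) (Suc (b q))) = (if q = p then 1 else 0)" if q: "q \<in> Q" for q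
  proof (cases "q = p")
    case False
    then have "b q \<notin> {b p..e p}" using disj[OF q assms] be[OF q] by auto
    then have "b q \<noteq> b p" "b q \<noteq> Suc (b p)" using bp by auto
    then show ?thesis using False by (simp add: minor2_def z_def)
  qed (simp add: minor2_def z_def)
  have "(\<Sum>q\<in>Q. subst z (minor2 1 2 (b q) (Suc (b q)))) = (\<Sum>q\<in>Q. if q = p then 1 else 0)"
    by (intro sum.cong refl minor)
  then have "subst z g = (\<Sum>q\<in>Q. if q = p then 1 else 0)"
    by (simp only: last_elem_def subst_simps d add_0)
  then have "subst z g \<noteq> 0" using Q assms by simp
  then show ?thesis
    using bp m D_le[OF assms] c by (intro reg_cyclic_diag_poly[where \<zeta> = z]) (auto simp: z_def)
qed

lemma reg_block:
  assumes "q \<in> Q"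
  shows "reg (minor_ideal UNIV (- ({1..m} \<times> {b q..e q}))) fs"
proof -
  have "reg (minor_ideal UNIV (- ({1..m} \<times> {b q..e q}))) (fs @ map (diag m n) [1 + b q + D..<Suc (m + e q)])"
    by (rule reg_cyclic_diag_block) (use be[OF assms] m D_le[OF assms] in auto)
  then show ?thesis by (simp only: reg_append)
qed

lemma reg_J:
  assumes "K \<subseteq> Q"
  shows "reg (J K) (fs @ [g])"
proof -
  have "finite K" using assms Q finite_subset by blast
  then show ?thesis using assms
  proof (induction K rule: finite_induct)
    case (insert q K)
    then have q: "q \<in> Q" "K \<subseteq> Q" "q \<notin> K" by auto
    show ?case
      unfolding J_insert(1)[OF q]
    proof (rule reg_Int)
      show "reg (ideal_sum (J K) (P q)) fs"
        unfolding J_insert(2)[OF q] by (rule reg_block[OF q(1)])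
    qed (use insert q reg_coordinate in auto)
  qed (rule reg_complete)
qed

lemma range_X_mem:
  "set (fs @ [g]) \<subseteq> gen (range X)"
proof -
  have X: "X v \<in> gen (range X)" for v by (simp add: rid.span_base)
  then have "minor2 i j k l \<in> gen (range X)" for i j k l
    unfolding minor2_def by (intro rid.span_diff rid.span_scale)
  then show ?thesis using X
    by (auto simp: cyclic_diag_def diag_def last_elem_def intro!: rid.span_sum rid.span_add)
qed

lemma J_socle: "\<exists>w. w \<notin> adjoin_list (J Q) (fs @ [g]) \<and> (\<forall>a\<in>gen (range X). a * w \<in> adjoin_list (J Q) (fs @ [g]))"
proof -
  \<comment> \<open>Part \<open>s\<close> is intersected last: for a shortest part, \<open>D\<close>
    is the number of antidiagonals of the block, as \<open>block_socle\<close> requires.\<close>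
  let ?K = "Q - {s}"
  have K: "s \<in> Q" "?K \<subseteq> Q" "s \<notin> ?K" and Q_eq: "insert s ?K = Q" using Q by auto
  note J = J_insert[OF K, unfolded Q_eq]
  have ideal_sum: "reg (ideal_sum (J ?K) (P s)) fs" unfolding J(2) by (rule reg_block[OF K(1)])
  note adjoin_list = adjoin_list_Int[OF Ideal_minor_ideal Ideal_minor_ideal ideal_sum]
  let ?A = "adjoin_list (J ?K) fs" and ?B = "adjoin_list (P s) fs"
  have "nzd g ?A" "nzd g ?B"
    using reg_J[OF K(2)] reg_coordinate[OF K(1)] by (simp_all add: reg_append)
  moreover have "g \<in> gen (range X)" using range_X_mem by simp
  moreover have "\<exists>u. u \<notin> ideal_sum ?A ?B \<and> (\<forall>a\<in>gen (range X). a * u \<in> ideal_sum ?A ?B)"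
    using adjoin_list block_socle[of "b s" "e s" n m] be[OF K(1)] m unfolding J(2) D by auto
  ultimately have "\<exists>w. w \<notin> adjoin (?A \<inter> ?B) g \<and> (\<forall>a\<in>gen (range X). a * w \<in> adjoin (?A \<inter> ?B) g)"
    using socle_Int[of ?A ?B g "gen (range X)"] Ideal_adjoin_list[OF Ideal_minor_ideal] by blast
  moreover have "adjoin_list (J Q) (fs @ [g]) = adjoin (?A \<inter> ?B) g"
    by (simp only: J(1) adjoin_list foldl_append foldl_Cons foldl_Nil)
  ultimately show ?thesis by simp
qed

lemma J_depth:
  "\<exists>hs. set hs \<subseteq> gen (range X) \<and> reg (J Q) hs \<and> length hs = Suc D"
  "set gs \<subseteq> gen (range X) \<Longrightarrow> reg (J Q) gs \<Longrightarrow> length gs \<le> Suc D"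
proof -
  show "\<exists>hs. set hs \<subseteq> gen (range X) \<and> reg (J Q) hs \<and> length hs = Suc D"
    using range_X_mem reg_J[of Q] by (intro exI[of _ "fs @ [g]"]) auto
  obtain w where "w \<notin> adjoin_list (J Q) (fs @ [g])" "\<forall>a\<in>gen (range X). a * w \<in> adjoin_list (J Q) (fs @ [g])"
    using J_socle by blast
  then show "set gs \<subseteq> gen (range X) \<Longrightarrow> reg (J Q) gs \<Longrightarrow> length gs \<le> Suc D"
    using regular_length_le[of "J Q" "fs @ [g]" w "gen (range X)" gs] reg_J[of Q] by simp
qed

end

section \<open>Depth over the polynomial ring\<close>

lemma poly_ring_simps [simp]:
  "monoid.mult (poly_ring m n) = (*)" "one (poly_ring m n) = 1"
  "zero (poly_ring m n) = 0" "add (poly_ring m n) = (+)"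
  by (simp_all add: poly_ring_def)

abbreviation outside :: "nat \<Rightarrow> nat \<Rightarrow> (nat \<times> nat) set" where
  "outside m n \<equiv> - ({1..m} \<times> {1..n})"

lemma uminus_in_poly_ring: "p \<in> carrier (poly_ring m n) \<Longrightarrow> - p \<in> carrier (poly_ring m n)"
  by (auto simp: poly_ring_def in_keys_iff)

lemma a_inv_poly_ring:
  assumes "p \<in> carrier (poly_ring m n)"
  shows "\<ominus>\<^bsub>poly_ring m n\<^esub> p = - p"
proof -
  interpret cring "poly_ring m n" by (rule poly_ring_cring)
  show ?thesis
    using assms uminus_in_poly_ring[OF assms] by (intro minus_equality) simp_all
qed

lemma a_minus_poly_ring:
  "p \<in> carrier (poly_ring m n) \<Longrightarrow> q \<in> carrier (poly_ring m n) \<Longrightarrow> p \<ominus>\<^bsub>poly_ring m n\<^esub> q = p - q"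
  by (simp add: a_minus_def a_inv_poly_ring)

lemma kill_in_poly_ring: "kill (outside m n) p \<in> carrier (poly_ring m n)"
proof -
  interpret cring "poly_ring m n" by (rule poly_ring_cring)
  show ?thesis
  proof (induction p rule: mpoly_induct)
    case (const c)
    show ?case by (simp add: kill_def) (simp add: poly_ring_def)
  next
    case (var v)
    show ?case
      using indet_in_poly_ring[of "fst v" m "snd v" n] zero_closed
      by (cases v) (auto simp: kill_X indet_eq)
  next
    case (add p q)
    then show ?case using a_closed by (simp add: kill_add)
  next
    case (mult p q)
    then show ?case using m_closed by (simp add: kill_mult)
  qed
qed

lemma kill_poly_ring:
  fixes p :: "'k::field mpoly"
  assumes "p \<in> carrier (poly_ring m n)"
  shows "kill (outside m n) p = p"
proof -
  have "kill (outside m n) p = lift (power_prod X) p"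
    unfolding kill_def subst_def lift_def
  proof (rule sum.cong[OF refl])
    fix t assume "t \<in> Poly_Mapping.keys p"
    then have "Poly_Mapping.keys t \<subseteq> {1..m} \<times> {1..n}" using assms by (simp add: poly_ring_def)
    then have "power_prod (\<lambda>v. if v \<in> outside m n then 0 else X v) t = (power_prod X t :: 'k mpoly)"
      unfolding power_prod_def by (intro prod.cong) auto
    then show "cst (Poly_Mapping.lookup p t) * power_prod (\<lambda>v. if v \<in> outside m n then 0 else X v) t
        = cst (Poly_Mapping.lookup p t) * power_prod X t" by (simp only:)
  qed
  then show ?thesis using subst_id[of p] by (simp add: subst_def)
qed

lemma kill_mem_iff:
  assumes "Ideal Y" "X ` outside m n \<subseteq> Y"
  shows "kill (outside m n) u \<in> Y \<longleftrightarrow> u \<in> Y"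
proof -
  have "u - kill (outside m n) u \<in> Y" by (rule kill_diff_in[OF assms(1)]) (rule subsetD[OF assms(2) imageI])
  from Ideal_diff_iff[OF assms(1) this] show ?thesis by simp
qed

lemma ideal_poly_ring:
  fixes Y :: "'k::field mpoly set"
  assumes "Ideal Y"
  shows "ideal (carrier (poly_ring m n) \<inter> Y) (poly_ring m n)"
proof -
  interpret cring "poly_ring m n" by (rule poly_ring_cring)
  show ?thesis
  proof (rule idealI[OF ring_axioms])
    show "subgroup (carrier (poly_ring m n) \<inter> Y) (add_monoid (poly_ring m n))"
    proof (rule subgroup.intro)
      show "inv\<^bsub>add_monoid (poly_ring m n)\<^esub> x \<in> carrier (poly_ring m n) \<inter> Y"
        if "x \<in> carrier (poly_ring m n) \<inter> Y" for x
        using that a_inv_poly_ring[of x m n] uminus_in_poly_ring[of x m n] rid.subspace_neg[OF assms, of x]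
        by (simp add: a_inv_def)
      show "x \<otimes>\<^bsub>add_monoid (poly_ring m n)\<^esub> y \<in> carrier (poly_ring m n) \<inter> Y"
        if "x \<in> carrier (poly_ring m n) \<inter> Y" "y \<in> carrier (poly_ring m n) \<inter> Y" for x y
        using that a_closed[of x y] rid.subspace_add[OF assms, of x y] by simp
    qed (use zero_closed rid.subspace_0[OF assms] in auto)
    fix a x :: "'k mpoly" assume "a \<in> carrier (poly_ring m n) \<inter> Y" "x \<in> carrier (poly_ring m n)"
    then show "x \<otimes>\<^bsub>poly_ring m n\<^esub> a \<in> carrier (poly_ring m n) \<inter> Y"
      and "a \<otimes>\<^bsub>poly_ring m n\<^esub> x \<in> carrier (poly_ring m n) \<inter> Y"
      using m_closed[of a x] m_closed[of x a] rid.subspace_scale[OF assms, of a x] Ideal_mult_right[OF assms, of a x]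
      by simp_all
  qed
qed

text \<open>\<open>kill (outside m n)\<close> retracts the whole polynomial type onto
  \<open>poly_ring m n\<close> and carries the enlarged ideal into the ideal generated by
  \<open>B\<close>.\<close>

lemma genideal_poly_ring:
  assumes "B \<subseteq> carrier (poly_ring m n)"
  shows "Idl\<^bsub>poly_ring m n\<^esub> B = carrier (poly_ring m n) \<inter> gen (B \<union> X ` outside m n)"
proof
  interpret cring "poly_ring m n" by (rule poly_ring_cring)
  show "Idl\<^bsub>poly_ring m n\<^esub> B \<subseteq> carrier (poly_ring m n) \<inter> gen (B \<union> X ` outside m n)"
    using assms rid.span_superset[of "B \<union> X ` outside m n"]
    by (intro genideal_minimal ideal_poly_ring) auto
  interpret I: ideal "Idl\<^bsub>poly_ring m n\<^esub> B" "poly_ring m n" by (rule genideal_ideal[OF assms])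
  have "Ideal {p. kill (outside m n) p \<in> Idl\<^bsub>poly_ring m n\<^esub> B}"
  proof (rule rid.subspaceI, unfold mem_Collect_eq)
    show "kill (outside m n) 0 \<in> Idl\<^bsub>poly_ring m n\<^esub> B"
      using I.zero_closed by (simp add: kill_def)
    show "kill (outside m n) (x + y) \<in> Idl\<^bsub>poly_ring m n\<^esub> B"
      if "kill (outside m n) x \<in> Idl\<^bsub>poly_ring m n\<^esub> B" "kill (outside m n) y \<in> Idl\<^bsub>poly_ring m n\<^esub> B" for x y
      using I.a_closed[OF that] by (simp add: kill_add)
    show "kill (outside m n) (c * x) \<in> Idl\<^bsub>poly_ring m n\<^esub> B"
      if "kill (outside m n) x \<in> Idl\<^bsub>poly_ring m n\<^esub> B" for c x
      using I.I_l_closed[OF that kill_in_poly_ring[of m n c]] by (simp add: kill_mult)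
  qed
  then have "gen (B \<union> X ` outside m n) \<subseteq> {p. kill (outside m n) p \<in> Idl\<^bsub>poly_ring m n\<^esub> B}"
  proof (rule rid.span_minimal[rotated])
    have "kill (outside m n) b \<in> Idl\<^bsub>poly_ring m n\<^esub> B" if "b \<in> B" for b
      using that assms genideal_self[OF assms] kill_poly_ring[of b m n] by auto
    then show "B \<union> X ` outside m n \<subseteq> {p. kill (outside m n) p \<in> Idl\<^bsub>poly_ring m n\<^esub> B}"
      using I.zero_closed by (auto simp: kill_X split: if_splits)
  qed
  then show "carrier (poly_ring m n) \<inter> gen (B \<union> X ` outside m n) \<subseteq> Idl\<^bsub>poly_ring m n\<^esub> B"
    using kill_poly_ring by fastforce
qed

section \<open>The quotient module in terms of ideals of the whole polynomial type\<close>

context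
  fixes m n :: nat and B :: "'k::field mpoly set" and J :: "'k mpoly set" and Y :: "'k mpoly set"
  assumes B: "B \<subseteq> carrier (poly_ring m n)"
    and J_def: "J = Idl\<^bsub>poly_ring m n\<^esub> B" and Y_def: "Y = gen (B \<union> X ` outside m n)"
begin

abbreviation (input) pring :: "'k mpoly ring" where "pring \<equiv> poly_ring m n"

abbreviation (input) qmod where "qmod \<equiv> quotient_module pring J"

interpretation pring: cring pring by (rule poly_ring_cring)

interpretation J: ideal J pring unfolding J_def by (rule pring.genideal_ideal[OF B])

interpretation h: ring_hom_ring pring "pring Quot J" "(+>\<^bsub>pring\<^esub>) J" by (rule J.rcos_ring_hom_ring)

interpretation qmod: Module.module pring qmod
  by (rule quotient_module_is_module[OF poly_ring_cring J.ideal_axioms])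

lemma J_eq: "J = carrier pring \<inter> Y"
  unfolding J_def Y_def by (rule genideal_poly_ring[OF B])

lemma carrier_M: "carrier qmod = (\<lambda>u. J +>\<^bsub>pring\<^esub> u) ` carrier pring"
  by (auto simp: quotient_module_simps FactRing_def A_RCOSETS_def')

lemma coset_eq_iff:
  "u \<in> carrier pring \<Longrightarrow> v \<in> carrier pring \<Longrightarrow> J +>\<^bsub>pring\<^esub> u = J +>\<^bsub>pring\<^esub> v \<longleftrightarrow> u - v \<in> Y"
  using pring.quotient_eq_iff_same_a_r_cos[OF J.ideal_axioms, of u v] pring.minus_closed[of u v]
  by (simp add: a_minus_poly_ring J_eq)

lemma coset_add:
  "u \<in> carrier pring \<Longrightarrow> v \<in> carrier pring \<Longrightarrow> (J +>\<^bsub>pring\<^esub> u) \<oplus>\<^bsub>qmod\<^esub> (J +>\<^bsub>pring\<^esub> v) = J +>\<^bsub>pring\<^esub> (u + v)"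
  using h.hom_add[of u v] by (simp add: quotient_module_simps)

lemma coset_smult:
  "u \<in> carrier pring \<Longrightarrow> v \<in> carrier pring \<Longrightarrow> u \<odot>\<^bsub>qmod\<^esub> (J +>\<^bsub>pring\<^esub> v) = J +>\<^bsub>pring\<^esub> (u * v)"
  using h.hom_mult[of u v] by (simp add: quotient_module_simps)

lemma coset_zero: "\<zero>\<^bsub>qmod\<^esub> = J +>\<^bsub>pring\<^esub> 0"
  using h.hom_zero by (simp add: quotient_module_simps)

lemma coset_uminus:
  assumes "u \<in> carrier pring"
  shows "\<ominus>\<^bsub>qmod\<^esub> (J +>\<^bsub>pring\<^esub> u) = J +>\<^bsub>pring\<^esub> (- u)"
proof (rule qmod.minus_equality)
  note u = uminus_in_poly_ring[OF assms]
  show "(J +>\<^bsub>pring\<^esub> (- u)) \<oplus>\<^bsub>qmod\<^esub> (J +>\<^bsub>pring\<^esub> u) = \<zero>\<^bsub>qmod\<^esub>"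
    by (simp only: coset_add[OF u assms] coset_zero left_minus)
  show "J +>\<^bsub>pring\<^esub> u \<in> carrier qmod" "J +>\<^bsub>pring\<^esub> (- u) \<in> carrier qmod"
    using assms u by (simp_all only: carrier_M imageI)
qed

lemma Y_props: "Ideal Y" "X ` outside m n \<subseteq> Y"
  using rid.span_superset[of "B \<union> X ` outside m n"] by (simp_all only: Y_def rid.subspace_span le_sup_iff)

text \<open>For the inclusion from right to left: the polynomials whose coset after
  \<open>kill\<close> lies in a given submodule \<open>N\<close> form an ideal, and this ideal
  contains \<open>A\<close> and \<open>Y\<close>.\<close>

lemma IM_span_eq:
  assumes A: "A \<subseteq> carrier pring"
  shows "IM_span pring qmod A = {J +>\<^bsub>pring\<^esub> u | u. u \<in> carrier pring \<inter> gen (A \<union> Y)}" (is "_ = ?N")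
proof
  have id: "Ideal (gen (A \<union> Y))" by simp
  have "submodule ?N pring qmod"
  proof (rule qmod.submoduleI)
    show "?N \<subseteq> carrier qmod" by (auto simp: carrier_M)
    show "\<zero>\<^bsub>qmod\<^esub> \<in> ?N" using pring.zero_closed rid.span_zero by (auto simp: coset_zero)
    show "\<ominus>\<^bsub>qmod\<^esub> a \<in> ?N" if "a \<in> ?N" for a
      using that coset_uminus uminus_in_poly_ring rid.span_neg by blast
    show "a \<oplus>\<^bsub>qmod\<^esub> b \<in> ?N" if ab: "a \<in> ?N" "b \<in> ?N" for a b
    proof -
      obtain u v where "a = J +>\<^bsub>pring\<^esub> u" "b = J +>\<^bsub>pring\<^esub> v" "u \<in> carrier pring \<inter> gen (A \<union> Y)" "v \<in> carrier pring \<inter> gen (A \<union> Y)"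
        using ab by blast
      then show ?thesis using coset_add[of u v] pring.a_closed[of u v] rid.span_add[of u _ v] by auto
    qed
    show "a \<odot>\<^bsub>qmod\<^esub> x \<in> ?N" if ax: "a \<in> carrier pring" "x \<in> ?N" for a x
    proof -
      obtain u where "x = J +>\<^bsub>pring\<^esub> u" "u \<in> carrier pring \<inter> gen (A \<union> Y)"
        using ax by blast
      then show ?thesis using ax coset_smult[of a u] pring.m_closed[of a u] rid.span_scale[of u _ a] by auto
    qed
  qed
  moreover have "{a \<odot>\<^bsub>qmod\<^esub> x | a x. a \<in> A \<and> x \<in> carrier qmod} \<subseteq> ?N"
  proof safe
    fix a x assume ax: "a \<in> A" "x \<in> carrier qmod"
    then obtain u where u: "x = J +>\<^bsub>pring\<^esub> u" "u \<in> carrier pring" by (auto simp: carrier_M)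
    have "a \<in> gen (A \<union> Y)" using ax by (simp add: rid.span_base)
    then have "a * u \<in> gen (A \<union> Y)" by (rule Ideal_mult_right[OF id])
    then show "\<exists>u. a \<odot>\<^bsub>qmod\<^esub> x = J +>\<^bsub>pring\<^esub> u \<and> u \<in> carrier pring \<inter> gen (A \<union> Y)"
      using ax A u coset_smult[of a u] pring.m_closed[of a u] by (intro exI[of _ "a * u"]) auto
  qed
  ultimately show "IM_span pring qmod A \<subseteq> ?N" unfolding IM_span_def by blast
  show "?N \<subseteq> IM_span pring qmod A"
    unfolding IM_span_def
  proof (intro Inter_greatest)
    fix N assume "N \<in> {N. submodule N pring qmod \<and> {a \<odot>\<^bsub>qmod\<^esub> x | a x. a \<in> A \<and> x \<in> carrier qmod} \<subseteq> N}"
    then have sub: "submodule N pring qmod" and AN: "\<And>a x. a \<in> A \<Longrightarrow> x \<in> carrier qmod \<Longrightarrow> a \<odot>\<^bsub>qmod\<^esub> x \<in> N"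
      by blast+
    note N = qmod.submoduleE[OF sub]
    let ?k = "kill (outside m n) :: 'k mpoly \<Rightarrow> 'k mpoly"
    obtain x where x: "x \<in> N" using N(2) by blast
    then have "\<zero>\<^bsub>pring\<^esub> \<odot>\<^bsub>qmod\<^esub> x \<in> N" using N(4) pring.zero_closed by blast
    then have "\<zero>\<^bsub>qmod\<^esub> \<in> N" using qmod.smult_l_null[of x] N(1) x by auto
    then have N0: "J +>\<^bsub>pring\<^esub> 0 \<in> N" by (simp add: coset_zero)
    have zero: "J +>\<^bsub>pring\<^esub> ?k y \<in> N" if "y \<in> Y" for y
      using that N0 coset_eq_iff[of "?k y" 0] kill_in_poly_ring[of m n y] pring.zero_closed kill_mem_iff[OF Y_props, of y]
      by simp
    have "Ideal {p. J +>\<^bsub>pring\<^esub> ?k p \<in> N}"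
    proof (rule rid.subspaceI, unfold mem_Collect_eq)
      show "J +>\<^bsub>pring\<^esub> ?k 0 \<in> N" using N0 by (simp add: kill_def)
      show "J +>\<^bsub>pring\<^esub> ?k (x + y) \<in> N" if "J +>\<^bsub>pring\<^esub> ?k x \<in> N" "J +>\<^bsub>pring\<^esub> ?k y \<in> N" for x y
        using N(5)[OF that] by (simp only: coset_add[OF kill_in_poly_ring kill_in_poly_ring] kill_add)
      show "J +>\<^bsub>pring\<^esub> ?k (c * x) \<in> N" if "J +>\<^bsub>pring\<^esub> ?k x \<in> N" for c x
        using N(4)[OF kill_in_poly_ring[of m n c] that]
        by (simp only: coset_smult[OF kill_in_poly_ring kill_in_poly_ring] kill_mult)
    qed
    moreover have "A \<union> Y \<subseteq> {p. J +>\<^bsub>pring\<^esub> ?k p \<in> N}"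
    proof -
      have "J +>\<^bsub>pring\<^esub> ?k a \<in> N" if a: "a \<in> A" for a
      proof -
        have "a \<odot>\<^bsub>qmod\<^esub> (J +>\<^bsub>pring\<^esub> 1) \<in> N"
          using AN[OF a, of "J +>\<^bsub>pring\<^esub> 1"] pring.one_closed by (simp add: carrier_M)
        then show ?thesis
          using a A coset_smult[of a 1] pring.one_closed kill_poly_ring[of a m n] by auto
      qed
      then show ?thesis using zero by blast
    qed
    ultimately have "gen (A \<union> Y) \<subseteq> {p. J +>\<^bsub>pring\<^esub> ?k p \<in> N}"
      by (intro rid.span_minimal)
    then show "?N \<subseteq> N" using kill_poly_ring by fastforce
  qed
qed

lemma coset_in_IM_span:
  assumes "A \<subseteq> carrier pring" "u \<in> carrier pring"
  shows "J +>\<^bsub>pring\<^esub> u \<in> IM_span pring qmod A \<longleftrightarrow> u \<in> gen (A \<union> Y)"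
proof
  assume "J +>\<^bsub>pring\<^esub> u \<in> IM_span pring qmod A"
  then obtain v where v: "J +>\<^bsub>pring\<^esub> u = J +>\<^bsub>pring\<^esub> v" "v \<in> carrier pring" "v \<in> gen (A \<union> Y)"
    using IM_span_eq[OF assms(1)] by auto
  then have "u - v \<in> gen (A \<union> Y)"
    using coset_eq_iff[OF assms(2) v(2)] rid.span_superset[of "A \<union> Y"] by blast
  then show "u \<in> gen (A \<union> Y)" using v(3) Ideal_diff_iff rid.subspace_span by blast
next
  assume "u \<in> gen (A \<union> Y)"
  then show "J +>\<^bsub>pring\<^esub> u \<in> IM_span pring qmod A" using IM_span_eq[OF assms(1)] assms(2) by auto
qed

lemma IM_span_eq_carrier_iff:
  assumes "A \<subseteq> carrier pring"
  shows "IM_span pring qmod A = carrier qmod \<longleftrightarrow> 1 \<in> gen (A \<union> Y)"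
proof
  assume "IM_span pring qmod A = carrier qmod"
  then have "J +>\<^bsub>pring\<^esub> 1 \<in> IM_span pring qmod A" using pring.one_closed by (simp add: carrier_M)
  then show "1 \<in> gen (A \<union> Y)" using coset_in_IM_span[OF assms, of 1] pring.one_closed by simp
next
  assume "1 \<in> gen (A \<union> Y)"
  then have "u \<in> gen (A \<union> Y)" for u using rid.span_scale[of 1 "A \<union> Y" u] by simp
  then show "IM_span pring qmod A = carrier qmod"
    unfolding IM_span_eq[OF assms] carrier_M by auto
qed

text \<open>\<open>kill (outside m n)\<close> is multiplicative, fixes each \<open>fs ! i\<close>
  and preserves membership, so a test element of the whole polynomial type can be moved into
  \<open>poly_ring m n\<close>.\<close>

lemma regular_sequence_iff:
  "regular_sequence pring qmod fs \<longleftrightarrow> set fs \<subseteq> carrier pring \<and> reg Y fs \<and> 1 \<notin> gen (set fs \<union> Y)"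
proof -
  have "(\<forall>x\<in>carrier qmod. fs ! i \<odot>\<^bsub>qmod\<^esub> x \<in> IM_span pring qmod (set (take i fs)) \<longrightarrow> x \<in> IM_span pring qmod (set (take i fs)))
     \<longleftrightarrow> (\<forall>u. fs ! i * u \<in> gen (set (take i fs) \<union> Y) \<longrightarrow> u \<in> gen (set (take i fs) \<union> Y))"
    if fs: "set fs \<subseteq> carrier pring" and i: "i < length fs" for i
  proof -
    let ?A = "set (take i fs)" and ?k = "kill (outside m n) :: 'k mpoly \<Rightarrow> 'k mpoly"
    have A: "?A \<subseteq> carrier pring" using fs set_take_subset[of i fs] by blast
    have f: "fs ! i \<in> carrier pring" using fs i by auto
    have out: "X ` outside m n \<subseteq> gen (?A \<union> Y)" using Y_props(2) rid.span_superset[of "?A \<union> Y"] by blast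
    note kill = kill_mem_iff[OF rid.subspace_span out]
    have "(\<forall>x\<in>carrier qmod. fs ! i \<odot>\<^bsub>qmod\<^esub> x \<in> IM_span pring qmod ?A \<longrightarrow> x \<in> IM_span pring qmod ?A)
      \<longleftrightarrow> (\<forall>u\<in>carrier pring. fs ! i * u \<in> gen (?A \<union> Y) \<longrightarrow> u \<in> gen (?A \<union> Y))"
    proof -
      have "fs ! i \<odot>\<^bsub>qmod\<^esub> (J +>\<^bsub>pring\<^esub> u) \<in> IM_span pring qmod ?A \<longleftrightarrow> fs ! i * u \<in> gen (?A \<union> Y)" if "u \<in> carrier pring" for u
        using coset_in_IM_span[OF A, of "fs ! i * u"] pring.m_closed[OF f that] coset_smult[OF f that] by simp
      then show ?thesis by (simp add: carrier_M coset_in_IM_span[OF A])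
    qed
    also have "\<dots> \<longleftrightarrow> (\<forall>u. fs ! i * u \<in> gen (?A \<union> Y) \<longrightarrow> u \<in> gen (?A \<union> Y))"
    proof (intro iffI allI impI)
      fix u assume *: "\<forall>u\<in>carrier pring. fs ! i * u \<in> gen (?A \<union> Y) \<longrightarrow> u \<in> gen (?A \<union> Y)"
        and "fs ! i * u \<in> gen (?A \<union> Y)"
      then have "?k (fs ! i * u) \<in> gen (?A \<union> Y)" by (simp only: kill)
      then have "fs ! i * ?k u \<in> gen (?A \<union> Y)" by (simp only: kill_mult kill_poly_ring[OF f])
      then have "?k u \<in> gen (?A \<union> Y)" using * kill_in_poly_ring by blast
      then show "u \<in> gen (?A \<union> Y)" by (simp only: kill)
    qed blast
    finally show ?thesis .
  qed
  moreover have "gen Y = Y" using Y_props(1) by simp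
  then have "reg Y fs \<longleftrightarrow> (\<forall>i < length fs. \<forall>u. fs ! i * u \<in> gen (set (take i fs) \<union> Y) \<longrightarrow> u \<in> gen (set (take i fs) \<union> Y))"
    using reg_iff_nth[of Y fs] by (simp only:)
  ultimately show ?thesis
    unfolding regular_sequence_def using IM_span_eq_carrier_iff[of "set fs"] by blast
qed

end

lemma one_notin_gen_X: "(1 :: 'k::field mpoly) \<notin> gen (range X)"
proof
  assume "(1 :: 'k mpoly) \<in> gen (range X)"
  then have "subst (\<lambda>_. 0) (1 :: 'k mpoly) \<in> {0}" by (rule subst_in_gen) auto
  then show False by simp
qed

lemma minor_ideal_subset_gen_X: "minor_ideal E Z \<subseteq> gen (range X)"
proof (rule minor_ideal_least)
  have X: "X v \<in> gen (range X)" for v by (simp add: rid.span_base)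
  then show "X v \<in> gen (range X)" for v .
  show "minor2 i j k l \<in> gen (range X)" for i j k l
    unfolding minor2_def by (intro rid.span_diff rid.span_scale X)
qed simp

lemma graded_maximal_ideal_eq:
  "(graded_maximal_ideal m n :: 'k::field mpoly set) = carrier (poly_ring m n) \<inter> gen (range X)"
proof -
  let ?B = "{indet i j | i j. i \<in> {1..m} \<and> j \<in> {1..n}} :: 'k mpoly set"
  have "?B = X ` ({1..m} \<times> {1..n})" by (auto simp: indet_eq) blast
  then have "?B \<union> X ` outside m n = range X" by (metis Un_UNIV_right Compl_partition image_Un)
  moreover have "?B \<subseteq> carrier (poly_ring m n)" using indet_in_poly_ring by blast
  ultimately show ?thesis unfolding graded_maximal_ideal_def by (simp only: genideal_poly_ring)
qed

section \<open>From the multipartite graph to blocks of columns\<close>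

definition block_start :: "(nat \<Rightarrow> nat) \<Rightarrow> nat \<Rightarrow> nat" where
  "block_start ns q = 1 + (\<Sum>j = 1..<q. ns j)"

definition block_end :: "(nat \<Rightarrow> nat) \<Rightarrow> nat \<Rightarrow> nat" where
  "block_end ns q = (\<Sum>j = 1..q. ns j)"

lemma multipartite_part_eq: "multipartite_part ns q = {block_start ns q..block_end ns q}"
  by (simp add: multipartite_part_def block_start_def block_end_def)

lemma block_end_eq: "1 \<le> q \<Longrightarrow> block_end ns q + 1 = block_start ns q + ns q"
proof -
  assume "1 \<le> q"
  then have "{1..q} = insert q {1..<q}" by auto
  then show ?thesis by (simp add: block_start_def block_end_def)
qed

lemma minor2_swap: "minor2 j i k l = - minor2 i j k l" "minor2 i j l k = - minor2 i j k l"
  by (simp_all add: minor2_def mult.commute)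

text \<open>A singleton part excludes no pair of distinct columns, so only the parts in
  \<open>Q\<close> matter. The further minors of \<open>minor_ideal\<close> are zero, equal a
  generator up to sign, or have a variable outside \<open>[m] \<times> [n]\<close> in each
  product.\<close>

lemma edge_ideal_eq:
  fixes ns :: "nat \<Rightarrow> nat" and m n r :: nat and Q :: "nat set"
  assumes n: "n = (\<Sum>j = 1..r. ns j)" and Q: "Q = {q \<in> {1..r}. ns q \<ge> 2}"
  defines "B \<equiv> {indet i k * indet j l - indet i l * indet j k | i j k l.
      1 \<le> i \<and> i < j \<and> j \<le> m \<and> {k, l} \<in> complete_multipartite_edges r ns \<and> k < l} :: 'k::field mpoly set"
  shows "gen (B \<union> X ` outside m n) = minor_ideal (pairs (block_start ns) (block_end ns) Q) (outside m n)" (is "_ = ?J")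
    and "B \<subseteq> carrier (poly_ring m n)"
proof -
  let ?G = "complete_multipartite_edges r ns"
  have B: "B = {minor2 i j k l | i j k l. 1 \<le> i \<and> i < j \<and> j \<le> m \<and> {k, l} \<in> ?G \<and> k < l}"
    by (simp add: B_def minor2_def indet_eq)
  have edge: "k \<in> {1..n} \<and> l \<in> {1..n}" if "{k, l} \<in> ?G" for k l
    using complete_multipartite_edges_simple[OF that] n by auto
  have same: "p = q" if "k \<in> multipartite_part ns p" "k \<in> multipartite_part ns q" "p \<in> {1..r}" "q \<in> {1..r}" for k p q
    using that multipartite_parts_disjoint[of p q ns] multipartite_parts_disjoint[of q p ns]
    by (metis IntI atLeastAtMost_iff empty_iff linorder_neqE_nat)
  have pairs: "(k, l) \<in> pairs (block_start ns) (block_end ns) Q" if "{k, l} \<in> ?G" for k l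
  proof -
    obtain u v p q where uv: "{k, l} = {u, v}" "p \<in> {1..r}" "q \<in> {1..r}" "p \<noteq> q"
      "u \<in> multipartite_part ns p" "v \<in> multipartite_part ns q"
      using \<open>{k, l} \<in> ?G\<close> unfolding complete_multipartite_edges_def by blast
    have "\<not> (k \<in> multipartite_part ns t \<and> l \<in> multipartite_part ns t)" if "t \<in> Q" for t
    proof
      assume "k \<in> multipartite_part ns t \<and> l \<in> multipartite_part ns t"
      then have "u \<in> multipartite_part ns t" "v \<in> multipartite_part ns t"
        using uv(1) by (auto simp: doubleton_eq_iff)
      then show False using same uv that Q by blast
    qed
    then show ?thesis by (auto simp: pairs_def multipartite_part_eq)
  qed
  have edges: "{k, l} \<in> ?G" if kl: "k \<in> {1..n}" "l \<in> {1..n}" "k \<noteq> l" "(k, l) \<in> pairs (block_start ns) (block_end ns) Q" for k l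
  proof -
    obtain p q where pq: "p \<in> {1..r}" "k \<in> multipartite_part ns p" "q \<in> {1..r}" "l \<in> multipartite_part ns q"
      using kl(1,2) unfolding n multipartite_parts_cover[symmetric] by blast
    have "p \<noteq> q"
    proof
      assume "p = q"
      then have "p \<notin> Q" using kl(4) pq by (auto simp: pairs_def multipartite_part_eq)
      then have "ns p < 2" using pq(1) Q by auto
      then show False
        using pq kl(3) \<open>p = q\<close> block_end_eq[of p ns] by (auto simp: multipartite_part_eq)
    qed
    then show ?thesis using pq unfolding complete_multipartite_edges_def by blast
  qed
  show "gen (B \<union> X ` outside m n) = ?J"
  proof
    show "gen (B \<union> X ` outside m n) \<subseteq> ?J"
      by (rule rid.span_minimal) (auto simp: B intro: minor2_in_minor_ideal pairs X_in_minor_ideal)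
    let ?Y = "gen (B \<union> X ` outside m n)"
    have X: "X v \<in> ?Y" if "v \<in> outside m n" for v using that by (auto intro: rid.span_base)
    show "?J \<subseteq> ?Y"
    proof (rule minor_ideal_least)
      fix i j k l assume kl: "(k, l) \<in> pairs (block_start ns) (block_end ns) Q"
      show "minor2 i j k l \<in> ?Y"
      proof (cases "i \<in> {1..m} \<and> j \<in> {1..m} \<and> k \<in> {1..n} \<and> l \<in> {1..n}")
        case False
        then have "(X (i, k) \<in> ?Y \<or> X (j, l) \<in> ?Y) \<and> (X (i, l) \<in> ?Y \<or> X (j, k) \<in> ?Y)"
          using X[of "(i, k)"] X[of "(j, l)"] X[of "(i, l)"] X[of "(j, k)"] by auto
        then show ?thesis
          unfolding minor2_def
          by (auto intro!: rid.span_diff intro: rid.span_scale Ideal_mult_right[OF rid.subspace_span])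
      next
        case True
        show ?thesis
        proof (cases "i = j \<or> k = l")
          case True
          then show ?thesis by (auto simp: minor2_def mult.commute rid.span_zero)
        next
          case False
          then have G: "{k, l} \<in> ?G" "{l, k} \<in> ?G"
            using edges[of k l] kl \<open>i \<in> {1..m} \<and> _\<close> by (auto simp: insert_commute)
          have base: "minor2 i j k l \<in> ?Y"
            if "1 \<le> i" "i < j" "j \<le> m" "{k, l} \<in> ?G" "k < l" for i j k l
            unfolding B using that by (intro rid.span_base) blast
          consider "i < j" "k < l" | "i < j" "l < k" | "j < i" "k < l" | "j < i" "l < k"
            using False by linarith
          then show ?thesis
          proof cases
            case 1
            then show ?thesis using base[of i j k l] G True by simp
          next
            case 2
            then have "minor2 i j l k \<in> ?Y" using base[of i j l k] G True by simp
            then show ?thesis by (subst minor2_swap(2)) (rule rid.span_neg)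
          next
            case 3
            then have "minor2 j i k l \<in> ?Y" using base[of j i k l] G True by simp
            then show ?thesis by (subst minor2_swap(1)) (rule rid.span_neg)
          next
            case 4
            then have "minor2 j i l k \<in> ?Y" using base[of j i l k] G True by simp
            then show ?thesis by (simp add: minor2_def mult.commute)
          qed
        qed
      qed
    qed (use X in auto)
  qed
  interpret cring "poly_ring m n :: 'k mpoly ring" by (rule poly_ring_cring)
  show "B \<subseteq> carrier (poly_ring m n)"
  proof
    fix x assume "x \<in> B"
    then obtain i j k l where x: "x = indet i k * indet j l - indet i l * indet j k"
      "i \<in> {1..m}" "j \<in> {1..m}" "k \<in> {1..n}" "l \<in> {1..n}"
      using edge unfolding B_def by fastforce
    have *: "indet i k * indet j l \<in> carrier (poly_ring m n :: 'k mpoly ring)"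
      "indet i l * indet j k \<in> carrier (poly_ring m n :: 'k mpoly ring)"
      using m_closed indet_in_poly_ring x(2-) by (metis poly_ring_simps(1))+
    show "x \<in> carrier (poly_ring m n)"
      using minus_closed[OF *] by (simp add: x(1) a_minus_poly_ring[OF *])
  qed
qed

theorem theorem3p6:
  fixes m r s n :: nat and ns :: "nat \<Rightarrow> nat"
    and S :: "'k::field mpoly ring" and G :: "nat set set"
  assumes "m \<ge> 2" and "r \<ge> 2"
    and "\<forall>j \<in> {1..r}. ns j \<ge> 1" and "ns r \<ge> 2"
    and "s \<in> {1..r}"
    and "\<forall>j \<in> {1..<s}. ns j = 1"
    and "1 < ns s"
    and "\<forall>j \<in> {s..<r}. ns j \<le> ns (j + 1)"
    and "n = (\<Sum>j = 1..r. ns j)"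
    and "G = complete_multipartite_edges r ns"
    and "S = poly_ring m n"
  shows "depth S (graded_maximal_ideal m n)
           (quotient_module S (gen_binomial_edge_ideal m n G)) = enat (m + ns s)"
proof -
  define Q where "Q = {q \<in> {1..r}. ns q \<ge> 2}"
  let ?b = "block_start ns" and ?e = "block_end ns"
  define D where "D = m + ?e s - ?b s"
  have s: "s \<in> {1..r}" by fact
  have mono: "ns s \<le> ns q" if "s \<le> q" "q \<le> r" for q
    using that
  proof (induction q rule: dec_induct)
    case (step q)
    then have "ns q \<le> ns (q + 1)" using assms(8) by auto
    with step show ?case by simp
  qed simp
  \<comment> \<open>Parts before \<open>s\<close> are singletons, so \<open>Q\<close> starts at
    \<open>s\<close>; as sizes do not decrease from there on, \<open>s\<close> is a shortest
    part.\<close>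
  have Q_ge: "s \<le> q" "q \<le> r" if "q \<in> Q" for q
    using that assms(6) by (force simp: Q_def not_le[symmetric])+
  have end_eq: "?e q + 1 = ?b q + ns q" if "q \<in> Q" for q
    using that by (intro block_end_eq) (simp add: Q_def)
  have sQ: "s \<in> Q" using s assms(7) by (simp add: Q_def)
  have "ns s + 1 \<le> n"
  proof -
    \<comment> \<open>Any second part supplies the column outside part \<open>s\<close> that the
      locale asks for.\<close>
    define t :: nat where "t = (if s = 1 then 2 else 1)"
    have t: "t \<in> {1..r}" "t \<noteq> s" using assms(2) by (auto simp: t_def)
    have "(\<Sum>j\<in>{s, t}. ns j) \<le> n" unfolding assms(9) using s t by (intro sum_mono2) auto
    moreover have "1 \<le> ns t" using t assms(3) by blast
    ultimately show ?thesis using t by simp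
  qed
  interpret blocks m n ?b ?e Q s D "TYPE('k)"
  proof
    show "1 \<le> ?b q \<and> ?b q < ?e q \<and> ?e q \<le> n" if q: "q \<in> Q" for q
    proof -
      have "?e q \<le> n"
        unfolding block_end_def assms(9) using q by (intro sum_mono2) (auto simp: Q_def)
      moreover have "2 \<le> ns q" using q by (simp add: Q_def)
      ultimately show ?thesis using end_eq[OF q] by (simp add: block_start_def)
    qed
    show "{?b p..?e p} \<inter> {?b q..?e q} = {}" if "p \<in> Q" "q \<in> Q" "p \<noteq> q" for p q
      using that multipartite_parts_disjoint[of p q ns] multipartite_parts_disjoint[of q p ns]
      unfolding multipartite_part_eq[symmetric] Q_def by (cases "p < q") auto
    show "?e s - ?b s \<le> ?e q - ?b q" if q: "q \<in> Q" for q
      using end_eq[OF q] end_eq[OF sQ] mono[of q] Q_ge[OF q] by linarith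
    show "?e s - ?b s + 2 \<le> n"
      using end_eq[OF sQ] \<open>ns s + 1 \<le> n\<close> assms(7) by linarith
  qed (use assms(1) sQ in \<open>auto simp: Q_def D_def\<close>)
  have D_eq: "Suc D = m + ns s" using end_eq[OF sQ] assms(7) by (simp add: D_def)
  define B where "B = ({indet i k * indet j l - indet i l * indet j k | i j k l.
      1 \<le> i \<and> i < j \<and> j \<le> m \<and> {k, l} \<in> G \<and> k < l} :: 'k mpoly set)"
  have B: "B \<subseteq> carrier (poly_ring m n)" and gen_B: "J Q = gen (B \<union> X ` outside m n)"
    using edge_ideal_eq(2)[OF assms(9) Q_def, of m] edge_ideal_eq(1)[OF assms(9) Q_def, of m, symmetric]
    by (simp_all only: B_def assms(10))
  define I where "I = (gen_binomial_edge_ideal m n G :: 'k mpoly set)"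
  have I: "I = Idl\<^bsub>poly_ring m n\<^esub> B" by (simp add: I_def gen_binomial_edge_ideal_def B_def)
  let ?M = "quotient_module (poly_ring m n) I" and ?m = "graded_maximal_ideal m n :: 'k mpoly set"
  note seq = regular_sequence_iff[OF B I gen_B]
  have max: "?m = carrier (poly_ring m n) \<inter> gen (range X)" by (rule graded_maximal_ideal_eq)
  have small: "1 \<notin> gen (A \<union> J Q)" if "A \<subseteq> gen (range X)" for A
    using rid.span_minimal[of "A \<union> J Q" "gen (range X)"] that minor_ideal_subset_gen_X one_notin_gen_X by blast
  then have "IM_span (poly_ring m n) ?M ?m \<noteq> carrier ?M"
    using IM_span_eq_carrier_iff[OF B I gen_B, of ?m] max by blast
  then have depth: "depth (poly_ring m n) ?m ?M
      = Sup {enat (length fs) | fs. set fs \<subseteq> ?m \<and> regular_sequence (poly_ring m n) ?M fs}"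
    by (simp add: depth_def)
  obtain hs where hs: "set hs \<subseteq> gen (range X)" "reg (J Q) hs" "length hs = Suc D"
    using J_depth(1) by blast
  \<comment> \<open>The sequence from the locale lives in the whole polynomial type; deleting the
    variables outside \<open>[m] \<times> [n]\<close> changes each element only by an element of
    \<open>J Q\<close>.\<close>
  let ?hs = "map (kill (outside m n)) hs"
  have "X ` outside m n \<subseteq> gen (range X)" using rid.span_superset[of "range X"] by blast
  from kill_mem_iff[OF rid.subspace_span this] have "kill (outside m n) x \<in> ?m" if "x \<in> set hs" for x
    using that hs(1) kill_in_poly_ring unfolding max by blast
  then have "set ?hs \<subseteq> ?m" by auto
  moreover have "reg (J Q) ?hs"
    using hs(2) by (rule reg_cong[OF Ideal_minor_ideal, rotated])
      (auto simp: list_all2_conv_all_nth intro!: kill_diff_in X_in_minor_ideal)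
  moreover have "1 \<notin> gen (set ?hs \<union> J Q)" using calculation(1) max by (intro small) blast
  ultimately have attained: "set ?hs \<subseteq> ?m \<and> regular_sequence (poly_ring m n) ?M ?hs"
    using seq[of ?hs] max by blast
  have bound: "length fs \<le> Suc D" if "set fs \<subseteq> ?m" "regular_sequence (poly_ring m n) ?M fs" for fs
    using that seq[of fs] J_depth(2)[of fs] max by blast
  have "depth (poly_ring m n) ?m ?M = enat (Suc D)"
    unfolding depth
  proof (rule antisym)
    show "Sup {enat (length fs) | fs. set fs \<subseteq> ?m \<and> regular_sequence (poly_ring m n) ?M fs} \<le> enat (Suc D)"
      using bound by (intro Sup_least) auto
    have "enat (length ?hs) \<le> Sup {enat (length fs) | fs. set fs \<subseteq> ?m \<and> regular_sequence (poly_ring m n) ?M fs}"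
      using attained by (intro Sup_upper) blast
    then show "enat (Suc D) \<le> Sup {enat (length fs) | fs. set fs \<subseteq> ?m \<and> regular_sequence (poly_ring m n) ?M fs}"
      using hs(3) by simp
  qed
  then show ?thesis by (simp only: assms(11) I_def D_eq)
qed

end
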